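(* Let $\mathcal A,\mathcal E$ be finite sets, $P_{A,E}$ a probability distribution on $\mathcal A\times\mathcal E$, $R>0$ and $\varepsilon>0$. Then $$\lim_{n\to\infty}\frac{-1}n\log\Delta_{d,\min}(e^{nR},\varepsilon|P_{A,E}^n)=\tilde e_d(P_{A,E}|R):=\max_{0\le s}\frac{s\bigl(H_{1+s}^\uparrow(A|E|P_{A,E})-R\bigr)}{1+2s},$$ $$\lim_{n\to\infty}\frac{-1}n\log\Delta_{I,\min}(e^{nR},\varepsilon|P_{A,E}^n)=\tilde e_I(P_{A,E}|R):=\max_{0\le s}\frac{sH_{1+s}^\downarrow(A|E|P_{A,E})-sR}{1+s},$$ where the maxima over $s\in[0,\infty)$ are understood as suprema.
   Context: Logarithms are natural. $P_{A,E}^n$ is the $n$-fold i.i.d. product distribution on $\mathcal A^n\times\mathcal E^n$. A sub-distribution is a nonnegative function with total sum $\le1$; $P_E(e)=\sum_aP_{A,E}(a,e)$; $\|\cdot\|_1$ is the sum of absolute values; $\eta(x,y)=xy-x\log x$. For $s>0$, $H_{1+s}^\downarrow(A|E|P_{A,E})=-\frac1s\log\sum_{a,e}P_{A,E}(a,e)^{1+s}P_E(e)^{-s}$ and $H_{1+s}^\uparrow(A|E|P_{A,E})=-\frac{1+s}{s}\log\sum_e(\sum_aP_{A,E}(a,e)^{1+s})^{\frac1{1+s}}$; for $s=0$ both are the conditional Shannon entropy. $H_{\min}(A|E|P\|Q_E)=-\log\max_{(a,e):Q_E(e)>0}\frac{P(a,e)}{Q_E(e)}$, with value $-\infty$ if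 $P(a,e)>0=Q_E(e)$ for some $(a,e)$; so $H_{\min}(A|E|P\|Q_E)\ge r$ iff $P(a,e)\le e^{-r}Q_E(e)$ for all $(a,e)$. For real $\mathsf M\ge1$, with outer minima understood as infima, $$\Delta_{d,\min}(\mathsf M,\varepsilon|P_{A,E})=\min_{Q_E}\min_{P'_{A,E}}\Bigl[2\|P_{A,E}-P'_{A,E}\|_1+\sqrt\varepsilon\,\mathsf M^{1/2}e^{-\frac12H_{\min}(A|E|P'_{A,E}\|Q_E)}\Bigr],$$ $$\Delta_{I,\min}(\mathsf M,\varepsilon|P_{A,E})=\min_{r\in\mathbb R}\Bigl[\eta\Bigl(\min_{P'_{A,E}:\,P'_E\le P_E,\ H_{\min}(A|E|P'_{A,E}\|P_E)\ge r}\|P_{A,E}-P'_{A,E}\|_1,\ \log\mathsf M\Bigr)+\varepsilon\mathsf M e^{-r}\Bigr],$$ where $Q_E$ ranges over probability distributions on $\mathcal E$ and $P'_{A,E}$ over sub-distributions on $\mathcal A\times\mathcal E$ (and correspondingly on $\mathcal A^n\times\mathcal E^n$ for $P_{A,E}^n$). *)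

theory Defs
  imports Complex_Main "HOL-Library.Extended_Real"
begin

text \<open>
  Distributions on a finite set are real-valued functions considered only on an explicit finite
  carrier; their values outside the carrier are irrelevant.  Joint functions on \<open>A \<times> E\<close> take pairs.
\<close>

definition prob_dist_on :: "'x set \<Rightarrow> ('x \<Rightarrow> real) \<Rightarrow> bool" where
  "prob_dist_on X P \<longleftrightarrow> (\<forall>x\<in>X. 0 \<le> P x) \<and> (\<Sum>x\<in>X. P x) = 1"

definition sub_dist_on :: "'x set \<Rightarrow> ('x \<Rightarrow> real) \<Rightarrow> bool" where
  "sub_dist_on X P \<longleftrightarrow> (\<forall>x\<in>X. 0 \<le> P x) \<and> (\<Sum>x\<in>X. P x) \<le> 1"

definition marginal_E :: "'a set \<Rightarrow> ('a \<times> 'e \<Rightarrow> real) \<Rightarrow> 'e \<Rightarrow> real" where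
  "marginal_E A P e = (\<Sum>a\<in>A. P (a, e))"

definition l1_norm_on :: "'x set \<Rightarrow> ('x \<Rightarrow> real) \<Rightarrow> real" where
  "l1_norm_on X f = (\<Sum>x\<in>X. \<bar>f x\<bar>)"

text \<open>\<open>A\<^sup>n\<close> is the set of words of length \<open>n\<close> over \<open>A\<close>; the product distribution lives on
  \<open>words A n \<times> words E n\<close>.\<close>

definition words :: "'x set \<Rightarrow> nat \<Rightarrow> 'x list set" where
  "words X n = {xs. set xs \<subseteq> X \<and> length xs = n}"

definition iid_power :: "nat \<Rightarrow> ('a \<times> 'e \<Rightarrow> real) \<Rightarrow> 'a list \<times> 'e list \<Rightarrow> real" where
  "iid_power n P = (\<lambda>(as, es). \<Prod>i<n. P (as ! i, es ! i))"

text \<open>The library values \<open>ln 0 = 0\<close>, \<open>x / 0 = 0\<close> and \<open>0 powr y = 0\<close> implement the usual conventions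
  by which terms with \<open>P (a, e) = 0\<close> contribute nothing below.\<close>

definition cond_entropy :: "'a set \<Rightarrow> 'e set \<Rightarrow> ('a \<times> 'e \<Rightarrow> real) \<Rightarrow> real" where
  "cond_entropy A E P =
     - (\<Sum>a\<in>A. \<Sum>e\<in>E. P (a, e) * ln (P (a, e) / marginal_E A P e))"

text \<open>In the next two definitions the argument \<open>s\<close> stands for the order \<open>1 + s\<close>.\<close>

definition H_down :: "'a set \<Rightarrow> 'e set \<Rightarrow> ('a \<times> 'e \<Rightarrow> real) \<Rightarrow> real \<Rightarrow> real" where
  "H_down A E P s =
     (if s = 0 then cond_entropy A E P
      else - (1 / s) * ln (\<Sum>a\<in>A. \<Sum>e\<in>E. P (a, e) powr (1 + s) * marginal_E A P e powr (- s)))"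

definition H_up :: "'a set \<Rightarrow> 'e set \<Rightarrow> ('a \<times> 'e \<Rightarrow> real) \<Rightarrow> real \<Rightarrow> real" where
  "H_up A E P s =
     (if s = 0 then cond_entropy A E P
      else - ((1 + s) / s) * ln (\<Sum>e\<in>E. (\<Sum>a\<in>A. P (a, e) powr (1 + s)) powr (1 / (1 + s))))"

text \<open>Extended-real logarithm of a nonnegative real, with \<open>log 0 = -\<infinity>\<close>, and the extended-real
  exponential, with \<open>exp (-\<infinity>) = 0\<close> and \<open>exp \<infinity> = \<infinity>\<close>.\<close>

definition eln :: "real \<Rightarrow> ereal" where
  "eln x = (if x \<le> 0 then -\<infinity> else ereal (ln x))"

definition eexp :: "ereal \<Rightarrow> ereal" where
  "eexp x = (if x = \<infinity> then \<infinity> else if x = -\<infinity> then 0 else ereal (exp (real_of_ereal x)))"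

definition H_min :: "'a set \<Rightarrow> 'e set \<Rightarrow> ('a \<times> 'e \<Rightarrow> real) \<Rightarrow> ('e \<Rightarrow> real) \<Rightarrow> ereal" where
  "H_min A E P Q =
     (if \<exists>a\<in>A. \<exists>e\<in>E. P (a, e) > 0 \<and> Q e = 0 then -\<infinity>
      else - eln (Max {P (a, e) / Q e | a e. a \<in> A \<and> e \<in> E \<and> Q e > 0}))"

lemma le_H_min_iff:
  assumes "finite A" "finite E" "A \<noteq> {}" "prob_dist_on E Q" "\<forall>x\<in>A \<times> E. 0 \<le> P x"
  shows "ereal r \<le> H_min A E P Q \<longleftrightarrow> (\<forall>a\<in>A. \<forall>e\<in>E. P (a, e) \<le> exp (- r) * Q e)"
proof (cases "\<exists>a\<in>A. \<exists>e\<in>E. P (a, e) > 0 \<and> Q e = 0")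
  case True
  then have "H_min A E P Q = -\<infinity>" unfolding H_min_def by simp
  moreover have "\<not> (\<forall>a\<in>A. \<forall>e\<in>E. P (a, e) \<le> exp (- r) * Q e)"
    using True by (metis mult_zero_right not_le)
  ultimately show ?thesis by simp
next
  case False
  define S where "S = {P (a, e) / Q e | a e. a \<in> A \<and> e \<in> E \<and> Q e > 0}"
  have Q: "\<forall>e\<in>E. 0 \<le> Q e" "sum Q E = 1"
    using assms(4) by (auto simp: prob_dist_on_def)
  have "S \<subseteq> (\<lambda>(a, e). P (a, e) / Q e) ` (A \<times> E)" unfolding S_def by auto
  then have fin: "finite S" by (rule finite_subset) (use assms in auto)
  have "\<exists>e\<in>E. Q e > 0"
    using Q by (metis less_eq_real_def sum.neutral zero_neq_one)
  then have ne: "S \<noteq> {}" using assms(3) unfolding S_def by blast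
  have "ereal r \<le> - eln (Max S) \<longleftrightarrow> Max S \<le> exp (- r)"
  proof (cases "Max S \<le> 0")
    case True
    then show ?thesis using order_trans[OF True, of "exp (- r)"] by (simp add: eln_def)
  next
    case False
    then have "Max S \<le> exp (- r) \<longleftrightarrow> ln (Max S) \<le> - r"
      by (metis exp_le_cancel_iff exp_ln not_le)
    then show ?thesis using False by (auto simp: eln_def)
  qed
  also have "\<dots> \<longleftrightarrow> (\<forall>x\<in>S. x \<le> exp (- r))"
    using fin ne by simp
  also have "\<dots> \<longleftrightarrow> (\<forall>a\<in>A. \<forall>e\<in>E. Q e > 0 \<longrightarrow> P (a, e) \<le> exp (- r) * Q e)"
    unfolding S_def by (force simp: divide_le_eq)
  also have "\<dots> \<longleftrightarrow> (\<forall>a\<in>A. \<forall>e\<in>E. P (a, e) \<le> exp (- r) * Q e)"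
    using False Q(1) by (metis less_eq_real_def mult_zero_right not_le)
  finally show ?thesis unfolding H_min_def if_not_P[OF False] S_def .
qed

definition eta :: "real \<Rightarrow> real \<Rightarrow> real" where
  "eta x y = x * y - x * ln x"

text \<open>The bracket is \<open>\<infinity>\<close> when \<open>H_min\<close> is \<open>-\<infinity>\<close>, so the infimum is taken in the extended reals.  The
  infimum is finite (lemma below), so that the conversion to a real is harmless.\<close>

definition Delta_d_bracket ::
    "'a set \<Rightarrow> 'e set \<Rightarrow> real \<Rightarrow> real \<Rightarrow> ('a \<times> 'e \<Rightarrow> real) \<Rightarrow> ('e \<Rightarrow> real) \<Rightarrow> ('a \<times> 'e \<Rightarrow> real) \<Rightarrow> ereal" where
  "Delta_d_bracket A E M \<epsilon> P Q P' =
     ereal (2 * l1_norm_on (A \<times> E) (\<lambda>x. P x - P' x))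
     + ereal (sqrt \<epsilon> * M powr (1 / 2)) * eexp (- (H_min A E P' Q / 2))"

definition Delta_d_min ::
    "'a set \<Rightarrow> 'e set \<Rightarrow> real \<Rightarrow> real \<Rightarrow> ('a \<times> 'e \<Rightarrow> real) \<Rightarrow> real" where
  "Delta_d_min A E M \<epsilon> P = real_of_ereal
     (INF Q\<in>{Q. prob_dist_on E Q}. INF P'\<in>{P'. sub_dist_on (A \<times> E) P'}. Delta_d_bracket A E M \<epsilon> P Q P')"

text \<open>Both infima below are over nonempty sets (\<open>P' = 0\<close> is always admissible) of nonnegative
  reals, provided \<open>P\<close> is a distribution and \<open>M \<ge> 1\<close>.\<close>

definition Delta_I_min ::
    "'a set \<Rightarrow> 'e set \<Rightarrow> real \<Rightarrow> real \<Rightarrow> ('a \<times> 'e \<Rightarrow> real) \<Rightarrow> real" where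
  "Delta_I_min A E M \<epsilon> P =
     (INF r\<in>UNIV.
        eta (INF P'\<in>{P'. sub_dist_on (A \<times> E) P'
                        \<and> (\<forall>e\<in>E. marginal_E A P' e \<le> marginal_E A P e)
                        \<and> ereal r \<le> H_min A E P' (marginal_E A P)}.
               l1_norm_on (A \<times> E) (\<lambda>x. P x - P' x))
            (ln M)
        + \<epsilon> * M * exp (- r))"

lemma Delta_d_finite:
  assumes "finite A" "finite E" "prob_dist_on (A \<times> E) P" "M \<ge> 1" "\<epsilon> > 0"
  shows "\<bar>INF Q\<in>{Q. prob_dist_on E Q}. INF P'\<in>{P'. sub_dist_on (A \<times> E) P'}.
            Delta_d_bracket A E M \<epsilon> P Q P'\<bar> \<noteq> \<infinity>"
    (is "\<bar>?I\<bar> \<noteq> \<infinity>")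
proof -
  have nonneg: "0 \<le> eexp x" for x by (simp add: eexp_def)
  have nn: "0 \<le> Delta_d_bracket A E M \<epsilon> P Q P'" for Q P'
    unfolding Delta_d_bracket_def l1_norm_on_def
    using assms(5) by (intro add_nonneg_nonneg ereal_0_le_mult nonneg) (auto intro!: sum_nonneg)
  then have low: "0 \<le> ?I" by (intro INF_greatest)
  define Q where "Q = marginal_E A P"
  have "sum Q E = sum P (A \<times> E)"
    unfolding Q_def marginal_E_def
    using assms(1,2) by (subst sum.swap) (simp add: sum.cartesian_product)
  then have Q: "prob_dist_on E Q"
    using assms(3) unfolding prob_dist_on_def Q_def marginal_E_def by (auto intro!: sum_nonneg)
  have A: "A \<noteq> {}" using assms(3) by (auto simp: prob_dist_on_def)
  have s0: "sub_dist_on (A \<times> E) (\<lambda>_. 0)" by (simp add: sub_dist_on_def)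
  have "ereal r \<le> H_min A E (\<lambda>_. 0) Q" for r
    using le_H_min_iff[OF assms(1,2) A Q, of "\<lambda>_. 0" r] Q by (simp add: prob_dist_on_def)
  then have "H_min A E (\<lambda>_. 0) Q = \<infinity>" using ereal_top by blast
  then have "Delta_d_bracket A E M \<epsilon> P Q (\<lambda>_. 0) \<noteq> \<infinity>"
    unfolding Delta_d_bracket_def by (simp add: eexp_def)
  moreover have "?I \<le> Delta_d_bracket A E M \<epsilon> P Q (\<lambda>_. 0)"
    using Q s0 by (intro INF_lower2[of Q] INF_lower2[of "\<lambda>_. 0"]) auto
  ultimately show ?thesis using low by auto
qed

text \<open>For a distribution \<open>P\<close> and \<open>s \<ge> 0\<close> both entropies are at most \<open>ln (card A)\<close>, so both suprema are over sets
  bounded above.\<close>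

definition e_d :: "'a set \<Rightarrow> 'e set \<Rightarrow> ('a \<times> 'e \<Rightarrow> real) \<Rightarrow> real \<Rightarrow> real" where
  "e_d A E P R = (SUP s\<in>{0..}. s * (H_up A E P s - R) / (1 + 2 * s))"

definition e_I :: "'a set \<Rightarrow> 'e set \<Rightarrow> ('a \<times> 'e \<Rightarrow> real) \<Rightarrow> real \<Rightarrow> real" where
  "e_I A E P R = (SUP s\<in>{0..}. (s * H_down A E P s - s * R) / (1 + s))"

end

theory Submission
  imports Defs "HOL-Real_Asymp.Real_Asymp"
begin

text \<open>
  For fixed \<open>Q\<close> and \<open>r\<close> the best approximation of \<open>P\<close> is \<open>min P (exp (- r) * Q)\<close>, with error
  \<open>\<Sum> max 0 (P - exp (- r) * Q)\<close>.  Achievability bounds this error by the moment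
  \<open>exp (r * s) * \<Sum> P powr (1 + s) * Q powr (- s)\<close>, taking for \<open>Q\<close> the marginal of \<open>P\<close> or the minimizer
  proportional to \<open>(\<Sum>\<^sub>a P powr (1 + s)) powr (1 / (1 + s))\<close>, and choosing \<open>r\<close> to balance the two summands
  of \<open>\<Delta>\<close>.

  For the converse, let \<open>v\<close> be a conditional probability of \<open>A\<close> given \<open>E\<close> (that of \<open>P\<close>, respectively of
  \<open>P powr (1 + s)\<close>), let \<open>W\<close> be proportional to \<open>P * v powr \<theta>\<close>, and test on the \<open>W\<close>-typical words.  With
  \<open>D\<close> the relative entropy of \<open>W\<close> from \<open>P\<close> and \<open>h\<close> the \<open>W\<close>-mean of \<open>- ln v\<close>, the exponent is at most
  \<open>max D (h - R)\<close>, respectively \<open>max D ((h + D - R) / 2)\<close>.  Because \<open>D = - ln Z - \<theta> * h\<close>, a weighted mean of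
  the two terms of the maximum is exactly the claimed exponent at \<open>s\<close>, so it suffices to find \<open>s\<close> where they
  balance.
\<close>

section \<open>One-shot bounds\<close>

text \<open>The hockey-stick divergence of \<open>P\<close> from the product of counting measure on
  \<open>A\<close> with \<open>Q\<close>, at threshold \<open>exp (- r)\<close>.\<close>

definition excess :: "'a set \<Rightarrow> 'e set \<Rightarrow> ('a \<times> 'e \<Rightarrow> real) \<Rightarrow> ('e \<Rightarrow> real) \<Rightarrow> real \<Rightarrow> real" where
  "excess A E P Q r = (\<Sum>x\<in>A \<times> E. max 0 (P x - exp (- r) * Q (snd x)))"

lemma prob_dist_on_marginal_E:
  assumes "finite A" "finite E" "prob_dist_on (A \<times> E) P"
  shows "prob_dist_on E (marginal_E A P)"
proof -
  have "sum (marginal_E A P) E = sum P (A \<times> E)"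
    unfolding marginal_E_def using assms(1,2)
    by (subst sum.swap) (simp add: sum.cartesian_product)
  then show ?thesis
    using assms(3) unfolding prob_dist_on_def marginal_E_def by (auto intro!: sum_nonneg)
qed

lemma prob_dist_on_Times_nonempty:
  assumes "prob_dist_on (A \<times> E) P"
  shows "A \<noteq> {}" "E \<noteq> {}"
  using assms by (auto simp: prob_dist_on_def)

lemma prob_dist_on_le_1:
  assumes "finite X" "prob_dist_on X P" "x \<in> X"
  shows "P x \<le> 1"
  using assms member_le_sum[of x X P] by (auto simp: prob_dist_on_def)

lemma excess_le_l1:
  assumes "\<forall>a\<in>A. \<forall>e\<in>E. P' (a, e) \<le> exp (- r) * Q e"
  shows "excess A E P Q r \<le> l1_norm_on (A \<times> E) (\<lambda>x. P x - P' x)"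
  unfolding excess_def l1_norm_on_def
  using assms by (intro sum_mono) fastforce

text \<open>The truncation lies below \<open>P\<close> pointwise, so the marginal constraint of
  \<open>Delta_I_min\<close> comes for free and one witness serves both quantities.\<close>

lemma excess_attained:
  assumes "finite A" "finite E" "prob_dist_on (A \<times> E) P" "\<forall>e\<in>E. 0 \<le> Q e"
    and P'_def: "P' = (\<lambda>x. min (P x) (exp (- r) * Q (snd x)))"
  shows "sub_dist_on (A \<times> E) P'"
    and "e \<in> E \<Longrightarrow> marginal_E A P' e \<le> marginal_E A P e"
    and "\<forall>a\<in>A. \<forall>e\<in>E. P' (a, e) \<le> exp (- r) * Q e"
    and "l1_norm_on (A \<times> E) (\<lambda>x. P x - P' x) = excess A E P Q r"
proof -
  have "sum P' (A \<times> E) \<le> sum P (A \<times> E)"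
    unfolding P'_def by (intro sum_mono) auto
  then show "sub_dist_on (A \<times> E) P'"
    using assms(3,4) by (auto simp: sub_dist_on_def prob_dist_on_def P'_def)
  show "marginal_E A P' e \<le> marginal_E A P e" if "e \<in> E"
    unfolding marginal_E_def P'_def by (intro sum_mono) auto
  show "\<forall>a\<in>A. \<forall>e\<in>E. P' (a, e) \<le> exp (- r) * Q e"
    by (auto simp: P'_def)
  show "l1_norm_on (A \<times> E) (\<lambda>x. P x - P' x) = excess A E P Q r"
    unfolding l1_norm_on_def excess_def P'_def
    by (intro sum.cong) (auto simp: min_def max_def)
qed

section \<open>Comparison of \<open>Delta_d_min\<close> with the excess\<close>

lemma eexp_mono: "x \<le> y \<Longrightarrow> eexp x \<le> eexp y"
  by (cases x; cases y) (auto simp: eexp_def)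

lemma eexp_nonneg: "0 \<le> eexp x"
  by (simp add: eexp_def)

lemma uminus_half_mono:
  fixes x y :: ereal
  shows "x \<le> y \<Longrightarrow> - (y / 2) \<le> - (x / 2)"
  by (simp add: ereal_divide_right_mono)

text \<open>The truncation has min-entropy at least \<open>r\<close>, and the second summand of the
  bracket decreases in the min-entropy. Both \<open>Q\<close> and \<open>r\<close> remain free for
  later optimization.\<close>

lemma Delta_d_min_le:
  assumes "finite A" "finite E" "prob_dist_on (A \<times> E) P" "M \<ge> 1" "\<epsilon> > 0" "prob_dist_on E Q"
  shows "Delta_d_min A E M \<epsilon> P
    \<le> 2 * excess A E P Q r + sqrt \<epsilon> * M powr (1 / 2) * exp (- r / 2)"
proof -
  define P' where "P' = (\<lambda>x. min (P x) (exp (- r) * Q (snd x)))"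
  have Q: "\<forall>e\<in>E. 0 \<le> Q e" using assms(6) by (auto simp: prob_dist_on_def)
  note P' = excess_attained[OF assms(1,2,3) Q P'_def]
  have "\<forall>x\<in>A \<times> E. 0 \<le> P' x" using P'(1) by (auto simp: sub_dist_on_def)
  then have "ereal r \<le> H_min A E P' Q"
    using le_H_min_iff[of A E Q P' r] assms prob_dist_on_Times_nonempty[OF assms(3)] P'(3) by auto
  then have "eexp (- (H_min A E P' Q / 2)) \<le> eexp (- (ereal r / 2))"
    by (intro eexp_mono uminus_half_mono)
  also have "\<dots> = ereal (exp (- r / 2))" by (simp add: eexp_def)
  finally have H: "eexp (- (H_min A E P' Q / 2)) \<le> ereal (exp (- r / 2))" .
  have "Delta_d_bracket A E M \<epsilon> P Q P'
      \<le> ereal (2 * excess A E P Q r) + ereal (sqrt \<epsilon> * M powr (1 / 2)) * ereal (exp (- r / 2))"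
    unfolding Delta_d_bracket_def P'(4)
    using assms(5) by (intro add_mono order_refl ereal_mult_left_mono H) auto
  then have "(INF Q\<in>{Q. prob_dist_on E Q}. INF P'\<in>{P'. sub_dist_on (A \<times> E) P'}.
        Delta_d_bracket A E M \<epsilon> P Q P')
      \<le> ereal (2 * excess A E P Q r + sqrt \<epsilon> * M powr (1 / 2) * exp (- r / 2))" (is "?I \<le> _")
    using assms(6) P'(1) by (intro INF_lower2[of Q] INF_lower2[of P']) auto
  \<comment> \<open>Finiteness makes \<open>real_of_ereal\<close> faithful, so the extended-real
    estimate passes to the real value.\<close>
  moreover have "\<bar>?I\<bar> \<noteq> \<infinity>" using Delta_d_finite[OF assms(1-5)] .
  ultimately show ?thesis unfolding Delta_d_min_def
    by (metis ereal_less_eq(3) ereal_real)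
qed

text \<open>The two summands cannot both be small: a competitor with min-entropy at least
  \<open>r\<close> has error at least the excess, and any other one has exponential factor at least
  \<open>exp (- r / 2)\<close>. The bound \<kappa> must hold for all \<open>Q\<close> because
  \<open>Q\<close> is minimized over too.\<close>

lemma Delta_d_min_ge:
  assumes "finite A" "finite E" "prob_dist_on (A \<times> E) P" "M \<ge> 1" "\<epsilon> > 0"
    and "\<And>Q. prob_dist_on E Q \<Longrightarrow> \<kappa> \<le> excess A E P Q r"
  shows "min (2 * \<kappa>) (sqrt \<epsilon> * M powr (1 / 2) * exp (- r / 2)) \<le> Delta_d_min A E M \<epsilon> P"
proof -
  define L where "L = min (2 * \<kappa>) (sqrt \<epsilon> * M powr (1 / 2) * exp (- r / 2))"
  have "ereal L \<le> Delta_d_bracket A E M \<epsilon> P Q P'"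
    if Q: "prob_dist_on E Q" and P': "sub_dist_on (A \<times> E) P'" for Q P'
  proof (cases "ereal r \<le> H_min A E P' Q")
    case True
    have "\<forall>x\<in>A \<times> E. 0 \<le> P' x" using P' by (auto simp: sub_dist_on_def)
    then have "\<forall>a\<in>A. \<forall>e\<in>E. P' (a, e) \<le> exp (- r) * Q e"
      using le_H_min_iff[of A E Q P' r] assms Q prob_dist_on_Times_nonempty[OF assms(3)] True by auto
    from excess_le_l1[OF this, of P] assms(6)[OF Q]
    have "ereal L \<le> ereal (2 * l1_norm_on (A \<times> E) (\<lambda>x. P x - P' x)) + 0"
      by (auto simp: L_def min_def split: if_splits)
    also have "\<dots> \<le> Delta_d_bracket A E M \<epsilon> P Q P'"
      unfolding Delta_d_bracket_def
      using assms(5) by (intro add_mono order_refl ereal_0_le_mult eexp_nonneg) auto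
    finally show ?thesis .
  next
    \<comment> \<open>This includes min-entropy -\<infinity>, where \<open>eexp\<close> returns
      \<infinity>.\<close>
    case False
    have "ereal (exp (- r / 2)) = eexp (- (ereal r / 2))" by (simp add: eexp_def)
    also have "\<dots> \<le> eexp (- (H_min A E P' Q / 2))"
      using False by (intro eexp_mono uminus_half_mono) auto
    finally have H: "ereal (exp (- r / 2)) \<le> eexp (- (H_min A E P' Q / 2))" .
    have "ereal L \<le> 0 + ereal (sqrt \<epsilon> * M powr (1 / 2)) * ereal (exp (- r / 2))"
      by (simp add: L_def)
    also have "\<dots> \<le> Delta_d_bracket A E M \<epsilon> P Q P'"
      unfolding Delta_d_bracket_def l1_norm_on_def
      using assms(5) by (intro add_mono ereal_mult_left_mono H) (auto intro!: sum_nonneg)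
    finally show ?thesis .
  qed
  then have "ereal L \<le> (INF Q\<in>{Q. prob_dist_on E Q}. INF P'\<in>{P'. sub_dist_on (A \<times> E) P'}.
        Delta_d_bracket A E M \<epsilon> P Q P')" (is "_ \<le> ?I")
    by (intro INF_greatest) auto
  moreover have "\<bar>?I\<bar> \<noteq> \<infinity>" using Delta_d_finite[OF assms(1-5)] .
  ultimately show ?thesis unfolding Delta_d_min_def L_def
    by (metis ereal_less_eq(3) ereal_real)
qed

section \<open>Comparison of \<open>Delta_I_min\<close> with the excess\<close>

lemma eta_le:
  assumes "0 \<le> x" "x \<le> u" "0 < u" "0 \<le> y"
  shows "eta x y \<le> u * (y + 1 + \<bar>ln u\<bar>)"
proof (cases "x = 0")
  case True
  then show ?thesis using assms by (simp add: eta_def)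
next
  case False
  then have x: "x > 0" using assms by simp
  \<comment> \<open>\<open>eta\<close> increases in \<open>x\<close> only up to
    \<open>exp (y - 1)\<close>, so \<open>u\<close> cannot simply be substituted for
    \<open>x\<close>; this inequality trades \<open>ln x\<close> for \<open>ln u\<close> at the cost
    of an additive \<open>u - x\<close>.\<close>
  have "x * ln (u / x) \<le> x * (u / x - 1)"
    using x assms by (intro mult_left_mono ln_le_minus_one) auto
  then have "x * ln u - x * ln x \<le> u - x"
    using x assms by (simp add: ln_div right_diff_distrib)
  moreover have "- x * ln u \<le> u * \<bar>ln u\<bar>"
    using mult_mono[of x u "\<bar>ln u\<bar>" "\<bar>ln u\<bar>"] assms abs_ge_minus_self[of "x * ln u"]
    by (simp add: abs_mult)
  moreover have "x * y \<le> u * y" using assms by (intro mult_right_mono) auto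
  ultimately show ?thesis using x by (simp add: eta_def algebra_simps)
qed

lemma eta_ge:
  assumes "0 \<le> x" "x \<le> 1"
  shows "x * y \<le> eta x y"
  using assms mult_nonneg_nonpos[of x "ln x"] by (cases "x = 0") (auto simp: eta_def)

definition smoothing_set ::
    "'a set \<Rightarrow> 'e set \<Rightarrow> ('a \<times> 'e \<Rightarrow> real) \<Rightarrow> real \<Rightarrow> ('a \<times> 'e \<Rightarrow> real) set" where
  "smoothing_set A E P r = {P'. sub_dist_on (A \<times> E) P'
      \<and> (\<forall>e\<in>E. marginal_E A P' e \<le> marginal_E A P e) \<and> ereal r \<le> H_min A E P' (marginal_E A P)}"

text \<open>The inner infimum is a minimum: feasibility forces \<open>P'\<close> below
  \<open>exp (- r)\<close> times the marginal, and the truncation is itself feasible.\<close>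

lemma smoothing_inf_eq_excess:
  assumes "finite A" "finite E" "prob_dist_on (A \<times> E) P"
  shows "(INF P'\<in>smoothing_set A E P r. l1_norm_on (A \<times> E) (\<lambda>x. P x - P' x))
    = excess A E P (marginal_E A P) r"
proof -
  note m = prob_dist_on_marginal_E[OF assms]
  have Q: "\<forall>e\<in>E. 0 \<le> marginal_E A P e" using m by (auto simp: prob_dist_on_def)
  define P' where "P' = (\<lambda>x. min (P x) (exp (- r) * marginal_E A P (snd x)))"
  note P' = excess_attained[OF assms Q P'_def]
  have le: "ereal r \<le> H_min A E P'' (marginal_E A P)
      \<longleftrightarrow> (\<forall>a\<in>A. \<forall>e\<in>E. P'' (a, e) \<le> exp (- r) * marginal_E A P e)"
    if "sub_dist_on (A \<times> E) P''" for P''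
    using that assms m prob_dist_on_Times_nonempty[OF assms(3)]
    by (intro le_H_min_iff) (auto simp: sub_dist_on_def)
  have "P' \<in> smoothing_set A E P r"
    using P'(1-3) le[OF P'(1)] by (auto simp: smoothing_set_def)
  moreover have "excess A E P (marginal_E A P) r \<le> l1_norm_on (A \<times> E) (\<lambda>x. P x - P'' x)"
    if "P'' \<in> smoothing_set A E P r" for P''
    using that le by (intro excess_le_l1) (auto simp: smoothing_set_def)
  ultimately show ?thesis
    using P'(4) by (intro cInf_eq_minimum) (auto intro!: image_eqI[of _ _ P'])
qed

lemma excess_bounds:
  assumes "finite A" "finite E" "prob_dist_on (A \<times> E) P" "\<forall>e\<in>E. 0 \<le> Q e"
  shows "0 \<le> excess A E P Q r" "excess A E P Q r \<le> 1"
proof -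
  show "0 \<le> excess A E P Q r" unfolding excess_def by (intro sum_nonneg) auto
  have "excess A E P Q r \<le> sum P (A \<times> E)"
    unfolding excess_def using assms(3,4) by (intro sum_mono) (auto simp: prob_dist_on_def)
  then show "excess A E P Q r \<le> 1" using assms(3) by (simp add: prob_dist_on_def)
qed

lemma excess_mono:
  assumes "\<forall>e\<in>E. 0 \<le> Q e" "r \<le> r'"
  shows "excess A E P Q r \<le> excess A E P Q r'"
proof -
  have "exp (- r') * Q e \<le> exp (- r) * Q e" if "e \<in> E" for e
    using that assms by (intro mult_right_mono) auto
  then show ?thesis
    unfolding excess_def by (intro sum_mono max.mono order_refl diff_left_mono) auto
qed

lemma Delta_I_min_altdef:
  assumes "finite A" "finite E" "prob_dist_on (A \<times> E) P"
  shows "Delta_I_min A E M \<epsilon> P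
    = (INF r. eta (excess A E P (marginal_E A P) r) (ln M) + \<epsilon> * M * exp (- r))"
  using smoothing_inf_eq_excess[OF assms] by (simp add: Delta_I_min_def smoothing_set_def)

lemma Delta_I_min_le:
  assumes "finite A" "finite E" "prob_dist_on (A \<times> E) P" "M \<ge> 1" "\<epsilon> > 0"
    and "excess A E P (marginal_E A P) r \<le> u" "0 < u"
  shows "Delta_I_min A E M \<epsilon> P \<le> u * (ln M + 1 + \<bar>ln u\<bar>) + \<epsilon> * M * exp (- r)"
proof -
  have Q: "\<forall>e\<in>E. 0 \<le> marginal_E A P e"
    using prob_dist_on_marginal_E[OF assms(1-3)] by (auto simp: prob_dist_on_def)
  note b = excess_bounds[OF assms(1-3) Q]
  \<comment> \<open>The infimum over \<open>r\<close> is taken in the reals, so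
    \<open>cINF_lower\<close> needs the family to be bounded below.\<close>
  have "0 \<le> eta (excess A E P (marginal_E A P) r) (ln M) + \<epsilon> * M * exp (- r)" for r
    using eta_ge[OF b, of r "ln M"] mult_nonneg_nonneg[OF b(1), of "ln M" r] assms(4,5)
    by (intro add_nonneg_nonneg) auto
  then have "Delta_I_min A E M \<epsilon> P
      \<le> eta (excess A E P (marginal_E A P) r) (ln M) + \<epsilon> * M * exp (- r)"
    unfolding Delta_I_min_altdef[OF assms(1-3)] by (intro cINF_lower bdd_belowI2[of _ 0]) auto
  also have "\<dots> \<le> u * (ln M + 1 + \<bar>ln u\<bar>) + \<epsilon> * M * exp (- r)"
    using assms b by (intro add_right_mono eta_le) auto
  finally show ?thesis .
qed

text \<open>With \<open>M\<close> at least \<open>exp 1\<close>, \<open>ln M\<close> is at least 1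
  and \<open>eta\<close> dominates the error itself. As \<open>r'\<close> grows the excess increases
  and the exponential decreases, so \<kappa> is a bound for \<open>r'\<close> above \<open>r\<close>
  and the value of the exponential at \<open>r\<close> is one for \<open>r'\<close> below.\<close>

lemma Delta_I_min_ge:
  assumes "finite A" "finite E" "prob_dist_on (A \<times> E) P" "M \<ge> exp 1" "\<epsilon> > 0"
    and "\<kappa> \<le> excess A E P (marginal_E A P) r"
  shows "min \<kappa> (\<epsilon> * M * exp (- r)) \<le> Delta_I_min A E M \<epsilon> P"
  unfolding Delta_I_min_altdef[OF assms(1-3)]
proof (intro cINF_greatest)
  fix r'
  have Q: "\<forall>e\<in>E. 0 \<le> marginal_E A P e"
    using prob_dist_on_marginal_E[OF assms(1-3)] by (auto simp: prob_dist_on_def)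
  note b = excess_bounds[OF assms(1-3) Q, of r']
  have M: "M > 0" "ln M \<ge> 1"
    using assms(4) exp_gt_zero[of 1] by (linarith, metis exp_gt_zero ln_exp ln_mono)
  have eta: "excess A E P (marginal_E A P) r' \<le> eta (excess A E P (marginal_E A P) r') (ln M)"
    using eta_ge[OF b, of "ln M"] mult_left_mono[OF M(2) b(1)] by simp
  show "min \<kappa> (\<epsilon> * M * exp (- r))
      \<le> eta (excess A E P (marginal_E A P) r') (ln M) + \<epsilon> * M * exp (- r')"
  proof (cases "r \<le> r'")
    case True
    have "0 \<le> \<epsilon> * M * exp (- r')" using M assms(5) by simp
    then show ?thesis using excess_mono[OF Q True, of A P] eta assms(6) by linarith
  next
    case False
    then have "\<epsilon> * M * exp (- r) \<le> \<epsilon> * M * exp (- r')" using M assms(5) by simp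
    then show ?thesis using eta b(1) by linarith
  qed
qed simp

section \<open>Product distributions and typical words\<close>

lemma words_0: "words X 0 = {[]}"
  by (auto simp: words_def)

lemma words_Suc: "words X (Suc n) = (\<lambda>(x, xs). x # xs) ` (X \<times> words X n)"
  by (auto simp: words_def length_Suc_conv)

lemma finite_words: "finite X \<Longrightarrow> finite (words X n)"
  by (simp add: words_def finite_lists_length_eq)

lemma nth_words: "xs \<in> words X n \<Longrightarrow> i < n \<Longrightarrow> xs ! i \<in> X"
  by (auto simp: words_def)

lemma nth_words_Times:
  "(as, es) \<in> words A n \<times> words E n \<Longrightarrow> i < n \<Longrightarrow> (as ! i, es ! i) \<in> A \<times> E"
  by (auto intro: nth_words)

text \<open>The distributive law. Factors may depend on the position, so that a fixed word
  \<open>es\<close> can enter through \<open>F i\<close> when marginals are computed.\<close>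

lemma sum_words_prod:
  fixes F :: "nat \<Rightarrow> 'x \<Rightarrow> real"
  shows "(\<Sum>xs\<in>words X n. \<Prod>i<n. F i (xs ! i)) = (\<Prod>i<n. \<Sum>x\<in>X. F i x)"
proof (induction n arbitrary: F)
  case 0
  then show ?case by (simp add: words_0)
next
  case (Suc n)
  have inj: "inj_on (\<lambda>(x, xs). x # xs) (X \<times> words X n)"
    by (auto simp: inj_on_def)
  have "(\<Sum>xs\<in>words X (Suc n). \<Prod>i<Suc n. F i (xs ! i))
      = (\<Sum>(x, xs)\<in>X \<times> words X n. F 0 x * (\<Prod>i<n. F (Suc i) (xs ! i)))"
    unfolding words_Suc sum.reindex[OF inj]
    by (intro sum.cong) (auto simp: prod.lessThan_Suc_shift simp del: prod.lessThan_Suc)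
  also have "\<dots> = (\<Sum>x\<in>X. F 0 x) * (\<Sum>xs\<in>words X n. \<Prod>i<n. F (Suc i) (xs ! i))"
    by (simp add: sum_product sum.cartesian_product)
  also have "\<dots> = (\<Prod>i<Suc n. \<Sum>x\<in>X. F i x)"
    unfolding Suc.IH[of "\<lambda>i. F (Suc i)"] prod.lessThan_Suc_shift ..
  finally show ?case .
qed

definition iid_sum :: "nat \<Rightarrow> ('a \<times> 'e \<Rightarrow> real) \<Rightarrow> 'a list \<times> 'e list \<Rightarrow> real" where
  "iid_sum n f = (\<lambda>(as, es). \<Sum>i<n. f (as ! i, es ! i))"

lemma marginal_iid_power:
  "marginal_E (words A n) (iid_power n P) es = (\<Prod>i<n. marginal_E A P (es ! i))"
  unfolding marginal_E_def iid_power_def prod.case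
  by (rule sum_words_prod[of "\<lambda>i a. P (a, es ! i)"])

lemma sum_iid_power:
  "(\<Sum>x\<in>words A n \<times> words E n. iid_power n F x) = (\<Sum>x\<in>A \<times> E. F x) ^ n"
proof -
  have "(\<Sum>x\<in>words A n \<times> words E n. iid_power n F x)
      = (\<Sum>es\<in>words E n. marginal_E (words A n) (iid_power n F) es)"
    unfolding marginal_E_def by (subst sum.swap) (simp add: sum.cartesian_product)
  also have "\<dots> = (\<Prod>i<n. \<Sum>e\<in>E. marginal_E A F e)"
    unfolding marginal_iid_power by (rule sum_words_prod)
  also have "\<dots> = (\<Sum>x\<in>A \<times> E. F x) ^ n"
    unfolding marginal_E_def by (subst sum.swap) (simp add: sum.cartesian_product)
  finally show ?thesis .
qed

lemma iid_power_nonneg: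
  assumes "\<forall>x\<in>A \<times> E. 0 \<le> F x" "x \<in> words A n \<times> words E n"
  shows "0 \<le> iid_power n F x"
  using assms nth_words_Times[of _ _ A n E] unfolding iid_power_def
  by (cases x) (auto intro!: prod_nonneg)

lemma iid_power_nonzero:
  "iid_power n F (as, es) \<noteq> 0 \<Longrightarrow> i < n \<Longrightarrow> F (as ! i, es ! i) \<noteq> 0"
  by (auto simp: iid_power_def prod_zero_iff)

lemma iid_power_mono:
  assumes "\<forall>x\<in>A \<times> E. 0 \<le> F x \<and> F x \<le> G x" "x \<in> words A n \<times> words E n"
  shows "iid_power n F x \<le> iid_power n G x"
  using assms nth_words_Times[of _ _ A n E] unfolding iid_power_def
  by (cases x) (auto intro!: prod_mono)

lemma prob_dist_on_iid_power:
  assumes "prob_dist_on (A \<times> E) P"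
  shows "prob_dist_on (words A n \<times> words E n) (iid_power n P)"
  using assms sum_iid_power[of n P A E] iid_power_nonneg[of A E P]
  by (auto simp: prob_dist_on_def)

lemma prob_dist_on_words:
  assumes "prob_dist_on E q"
  shows "prob_dist_on (words E n) (\<lambda>es. \<Prod>i<n. q (es ! i))"
  using assms sum_words_prod[of "\<lambda>_. q" n E] nth_words[of _ E n]
  by (auto simp: prob_dist_on_def intro!: prod_nonneg)

lemma iid_power_mult_exp:
  "iid_power n (\<lambda>x. W x * exp (f x)) x = iid_power n W x * exp (iid_sum n f x)"
  by (cases x) (simp add: iid_power_def iid_sum_def prod.distrib exp_sum)

lemma iid_sum_cmult: "iid_sum n (\<lambda>x. c * f x) x = c * iid_sum n f x"
  by (cases x) (simp add: iid_sum_def sum_distrib_left)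

lemma iid_sum_diff_const: "iid_sum n (\<lambda>x. f x - c) x = iid_sum n f x - real n * c"
  by (cases x) (simp add: iid_sum_def sum_subtractf)

section \<open>Concentration of i.i.d. sums and typical sets\<close>

lemma exp_le_quadratic:
  fixes y :: real
  assumes "\<bar>y\<bar> \<le> 1"
  shows "exp y \<le> 1 + y + y\<^sup>2"
proof (cases "y \<ge> 0")
  case True
  then show ?thesis using assms exp_bound[of y] by simp
next
  case False
  \<comment> \<open>For negative \<open>y\<close> the claim follows from
    \<open>exp (- y) \<ge> 1 - y\<close>, since this product is \<open>1 - y^3\<close> and hence at
    least 1.\<close>
  have "(1 - y) * (1 + y + y\<^sup>2) = 1 - y * y\<^sup>2"
    by (simp add: algebra_simps power2_eq_square)
  moreover have "y * y\<^sup>2 \<le> 0" using False by (intro mult_nonpos_nonneg) auto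
  ultimately have "1 \<le> (1 - y) * (1 + y + y\<^sup>2)" by simp
  also have "\<dots> \<le> exp (- y) * (1 + y + y\<^sup>2)"
    using exp_ge_add_one_self[of "- y"] assms zero_le_power2[of y]
    by (intro mult_right_mono) (simp_all add: abs_le_iff)
  finally show ?thesis by (simp add: exp_minus field_simps)
qed

text \<open>Chernoff's bound: on the deviating words the tilted weight is at least 1, so their mass
  is at most \<open>c ^ n\<close>, where \<open>c\<close> is the one-letter exponential moment. A
  small enough \<open>t\<close> makes \<open>c < 1\<close>.\<close>

lemma large_deviation_tendsto_0:
  fixes f :: "'a \<times> 'e \<Rightarrow> real"
  assumes "finite A" "finite E" "prob_dist_on (A \<times> E) W" "\<gamma> > 0"
  defines "\<mu> \<equiv> (\<Sum>x\<in>A \<times> E. W x * f x)"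
  shows "(\<lambda>n. \<Sum>x\<in>{x \<in> words A n \<times> words E n. iid_sum n f x > real n * (\<mu> + \<gamma>)}. iid_power n W x)
    \<longlonglongrightarrow> 0"
proof -
  have W: "W x \<ge> 0" if "x \<in> A \<times> E" for x
    using assms(3) that by (auto simp: prob_dist_on_def)
  have W1: "sum W (A \<times> E) = 1"
    using assms(3) by (auto simp: prob_dist_on_def)
  define B where "B = 1 + (\<Sum>x\<in>A \<times> E. \<bar>f x - \<mu>\<bar>)"
  have B: "B \<ge> 1" unfolding B_def by (simp add: sum_nonneg)
  have fB: "\<bar>f x - \<mu>\<bar> \<le> B" if "x \<in> A \<times> E" for x
    using member_le_sum[of x "A \<times> E" "\<lambda>x. \<bar>f x - \<mu>\<bar>"] that assms(1,2) by (simp add: B_def)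
  \<comment> \<open>The first bound keeps the exponents in the range of
    \<open>exp_le_quadratic\<close>; the second makes the quadratic loss
    \<open>(t * B)\<^sup>2\<close> smaller than the linear gain \<open>t * \<gamma>\<close>. The 1
    in \<open>B\<close> excludes division by zero when \<open>f\<close> is constant.\<close>
  define t where "t = min (1 / B) (\<gamma> / (2 * B\<^sup>2))"
  have t: "t > 0" "t * B \<le> 1" "t * B\<^sup>2 < \<gamma>"
  proof -
    show "t > 0" using B assms(4) by (simp add: t_def)
    show "t * B \<le> 1" using B mult_right_mono[of t "1 / B" B] by (simp add: t_def)
    have "t * B\<^sup>2 \<le> \<gamma> / (2 * B\<^sup>2) * B\<^sup>2" unfolding t_def by (intro mult_right_mono) auto
    then show "t * B\<^sup>2 < \<gamma>" using B assms(4) by simp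
  qed
  define c where "c = (\<Sum>x\<in>A \<times> E. W x * exp (t * (f x - (\<mu> + \<gamma>))))"
  have c0: "c \<ge> 0" unfolding c_def by (intro sum_nonneg mult_nonneg_nonneg W) auto
  have "(\<Sum>x\<in>A \<times> E. W x * exp (t * (f x - \<mu>)))
      \<le> (\<Sum>x\<in>A \<times> E. W x * (1 + t * (f x - \<mu>) + (t * B)\<^sup>2))"
  proof (intro sum_mono mult_left_mono W)
    fix x assume x: "x \<in> A \<times> E"
    have le: "\<bar>t * (f x - \<mu>)\<bar> \<le> t * B"
      using fB[OF x] t(1) by (simp add: abs_mult)
    then have "(t * (f x - \<mu>))\<^sup>2 \<le> (t * B)\<^sup>2"
      by (metis abs_ge_zero power2_abs power_mono)
    moreover have "exp (t * (f x - \<mu>)) \<le> 1 + t * (f x - \<mu>) + (t * (f x - \<mu>))\<^sup>2"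
      using le t(2) by (intro exp_le_quadratic) linarith
    ultimately show "exp (t * (f x - \<mu>)) \<le> 1 + t * (f x - \<mu>) + (t * B)\<^sup>2" by linarith
  qed
  also have "\<dots> = 1 + (t * B)\<^sup>2"
  proof -
    have "(\<Sum>x\<in>A \<times> E. W x * (1 + t * (f x - \<mu>) + (t * B)\<^sup>2))
        = (\<Sum>x\<in>A \<times> E. W x * (1 - t * \<mu> + (t * B)\<^sup>2) + t * (W x * f x))"
      by (intro sum.cong) (auto simp: algebra_simps)
    also have "\<dots> = sum W (A \<times> E) * (1 - t * \<mu> + (t * B)\<^sup>2) + t * \<mu>"
      unfolding sum.distrib sum_distrib_right[symmetric] sum_distrib_left[symmetric] \<mu>_def ..
    finally show ?thesis using W1 by simp
  qed
  also have "\<dots> \<le> exp ((t * B)\<^sup>2)" by (rule exp_ge_add_one_self)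
  finally have m: "(\<Sum>x\<in>A \<times> E. W x * exp (t * (f x - \<mu>))) \<le> exp ((t * B)\<^sup>2)" .
  have "c = exp (- (t * \<gamma>)) * (\<Sum>x\<in>A \<times> E. W x * exp (t * (f x - \<mu>)))"
    unfolding c_def sum_distrib_left
    by (intro sum.cong) (auto simp: algebra_simps exp_add[symmetric])
  also have "\<dots> \<le> exp (- (t * \<gamma>)) * exp ((t * B)\<^sup>2)" using m by simp
  also have "\<dots> = exp (t * (t * B\<^sup>2 - \<gamma>))"
    by (simp add: exp_add[symmetric] power2_eq_square algebra_simps)
  also have "\<dots> < 1" using t by (simp add: mult_pos_neg)
  finally have c1: "c < 1" .
  have lim: "(\<lambda>n. c ^ n) \<longlonglongrightarrow> 0" using c0 c1 by (rule LIMSEQ_realpow_zero)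
  show ?thesis
  proof (rule tendsto_sandwich[OF always_eventually always_eventually tendsto_const lim];
      intro allI)
    fix n
    let ?X = "words A n \<times> words E n"
    let ?bad = "{x \<in> ?X. iid_sum n f x > real n * (\<mu> + \<gamma>)}"
    have Wn: "iid_power n W x \<ge> 0" if "x \<in> ?X" for x
      using that W by (intro iid_power_nonneg[of A E]) auto
    show "0 \<le> (\<Sum>x\<in>?bad. iid_power n W x)" using Wn by (intro sum_nonneg) auto
    let ?g = "\<lambda>x. t * (f x - (\<mu> + \<gamma>))"
    have fin: "finite ?X" using assms(1,2) by (simp add: finite_words)
    have "(\<Sum>x\<in>?bad. iid_power n W x) \<le> (\<Sum>x\<in>?bad. iid_power n W x * exp (iid_sum n ?g x))"
    proof (intro sum_mono)
      fix x assume x: "x \<in> ?bad"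
      then have "iid_sum n ?g x \<ge> 0"
        using t(1) unfolding iid_sum_cmult iid_sum_diff_const by simp
      then show "iid_power n W x \<le> iid_power n W x * exp (iid_sum n ?g x)"
        using Wn[of x] x mult_left_mono[of 1 "exp (iid_sum n ?g x)" "iid_power n W x"] by simp
    qed
    also have "\<dots> \<le> (\<Sum>x\<in>?X. iid_power n W x * exp (iid_sum n ?g x))"
      using fin Wn by (intro sum_mono2) auto
    also have "\<dots> = c ^ n"
      unfolding iid_power_mult_exp[symmetric] sum_iid_power c_def ..
    finally show "(\<Sum>x\<in>?bad. iid_power n W x) \<le> c ^ n" .
  qed
qed

text \<open>Each of the two one-sided deviations eventually has mass below 1/4, so a union bound
  leaves at least 1/2.\<close>

lemma typical_words:
  fixes f g :: "'a \<times> 'e \<Rightarrow> real"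
  assumes "finite A" "finite E" "prob_dist_on (A \<times> E) W" "\<gamma> > 0"
  defines "\<mu> \<equiv> (\<Sum>x\<in>A \<times> E. W x * f x)"
  defines "\<nu> \<equiv> (\<Sum>x\<in>A \<times> E. W x * g x)"
  shows "\<forall>\<^sub>F n in sequentially. 1 / 2 \<le>
    (\<Sum>x\<in>{x \<in> words A n \<times> words E n. iid_sum n f x \<le> real n * (\<mu> + \<gamma>)
            \<and> iid_sum n g x \<le> real n * (\<nu> + \<gamma>)}. iid_power n W x)"
proof -
  let ?bad = "\<lambda>h m n. {x \<in> words A n \<times> words E n. iid_sum n h x > real n * (m + \<gamma>)}"
  have lim: "(\<lambda>n. \<Sum>x\<in>?bad f \<mu> n. iid_power n W x) \<longlonglongrightarrow> 0"
    "(\<lambda>n. \<Sum>x\<in>?bad g \<nu> n. iid_power n W x) \<longlonglongrightarrow> 0"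
    unfolding \<mu>_def \<nu>_def using assms(1-4) by (auto intro!: large_deviation_tendsto_0)
  have "\<forall>\<^sub>F n in sequentially. (\<Sum>x\<in>?bad f \<mu> n. iid_power n W x) < 1 / 4
      \<and> (\<Sum>x\<in>?bad g \<nu> n. iid_power n W x) < 1 / 4"
    using order_tendstoD(2)[OF lim(1), of "1 / 4"] order_tendstoD(2)[OF lim(2), of "1 / 4"]
    by (auto simp: eventually_conj_iff)
  then show ?thesis
  proof eventually_elim
    case (elim n)
    let ?X = "words A n \<times> words E n"
    let ?good = "{x \<in> ?X. iid_sum n f x \<le> real n * (\<mu> + \<gamma>) \<and> iid_sum n g x \<le> real n * (\<nu> + \<gamma>)}"
    have fin: "finite ?X" using assms(1,2) by (simp add: finite_words)
    have Wn: "iid_power n W x \<ge> 0" if "x \<in> ?X" for x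
      using that assms(3) by (intro iid_power_nonneg[of A E]) (auto simp: prob_dist_on_def)
    have "1 = sum (iid_power n W) ?X"
      using prob_dist_on_iid_power[OF assms(3)] by (simp add: prob_dist_on_def)
    also have "\<dots> \<le> sum (iid_power n W) (?good \<union> (?bad f \<mu> n \<union> ?bad g \<nu> n))"
      using fin Wn by (intro sum_mono2) auto
    also have "\<dots> \<le> sum (iid_power n W) ?good + sum (iid_power n W) (?bad f \<mu> n \<union> ?bad g \<nu> n)"
      using fin Wn by (subst sum_Un) (auto intro!: sum_nonneg)
    also have "sum (iid_power n W) (?bad f \<mu> n \<union> ?bad g \<nu> n)
        \<le> sum (iid_power n W) (?bad f \<mu> n) + sum (iid_power n W) (?bad g \<nu> n)"
      using fin Wn by (subst sum_Un) (auto intro!: sum_nonneg)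
    finally show ?case using elim by simp
  qed
qed

text \<open>Change of measure: on words whose log-likelihood ratio is at most
  \<open>n * (D + \<gamma>)\<close>, the \<open>P\<close>-mass is at least
  \<open>exp (- (n * (D + \<gamma>)))\<close> times the \<open>W\<close>-mass, which is at least
  1/2.\<close>

lemma typical_set_exists:
  fixes P v W :: "'a \<times> 'e \<Rightarrow> real"
  assumes "finite A" "finite E" "prob_dist_on (A \<times> E) W" "\<gamma> > 0"
    and "\<forall>x\<in>A \<times> E. 0 \<le> P x \<and> 0 \<le> v x"
    and "\<forall>x\<in>A \<times> E. W x > 0 \<longrightarrow> P x > 0 \<and> v x > 0"
  defines "D \<equiv> (\<Sum>x\<in>A \<times> E. W x * ln (W x / P x))"
  defines "h \<equiv> (\<Sum>x\<in>A \<times> E. W x * - ln (v x))"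
  shows "\<forall>\<^sub>F n in sequentially. \<exists>S\<subseteq>words A n \<times> words E n.
    (\<forall>x\<in>S. exp (- (real n * (h + \<gamma>))) \<le> iid_power n v x)
    \<and> exp (- (real n * (D + \<gamma>))) / 2 \<le> sum (iid_power n P) S"
proof -
  let ?f = "\<lambda>x. ln (W x / P x)" and ?g = "\<lambda>x. - ln (v x)"
  have W: "\<forall>x\<in>A \<times> E. 0 \<le> W x" using assms(3) by (auto simp: prob_dist_on_def)
  have "\<forall>\<^sub>F n in sequentially. 1 / 2 \<le>
    (\<Sum>x\<in>{x \<in> words A n \<times> words E n. iid_sum n ?f x \<le> real n * (D + \<gamma>)
            \<and> iid_sum n ?g x \<le> real n * (h + \<gamma>)}. iid_power n W x)"
    unfolding D_def h_def using assms(1-4) by (rule typical_words)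
  then show ?thesis
  proof eventually_elim
    case (elim n)
    let ?X = "words A n \<times> words E n"
    define T where "T = {x \<in> ?X. iid_sum n ?f x \<le> real n * (D + \<gamma>) \<and> iid_sum n ?g x \<le> real n * (h + \<gamma>)}"
    \<comment> \<open>Words of \<open>W\<close>-mass zero are removed: there the logarithms may have
      default values, and no \<open>W\<close>-mass is lost. On \<open>S\<close> every letter has
      positive \<open>W\<close>, hence positive \<open>P\<close> and \<open>v\<close>.\<close>
    define S where "S = {x \<in> T. iid_power n W x > 0}"
    have fin: "finite T" using assms(1,2) by (simp add: finite_words T_def)
    have Wn: "0 \<le> iid_power n W x" if "x \<in> T" for x
      using that by (intro iid_power_nonneg[OF W]) (auto simp: T_def)
    have ST: "sum (iid_power n W) S = sum (iid_power n W) T"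
      using fin Wn by (intro sum.mono_neutral_left) (fastforce simp: S_def)+
    have "exp (- (real n * (h + \<gamma>))) \<le> iid_power n v x" if x: "x \<in> S" for x
    proof -
      obtain as es where xe: "x = (as, es)" by fastforce
      have mem: "(as ! i, es ! i) \<in> A \<times> E" if "i < n" for i
        using that x nth_words_Times[of as es A n E i] unfolding xe S_def T_def by blast
      have "W (as ! i, es ! i) > 0" if "i < n" for i
      proof -
        have "W (as ! i, es ! i) \<noteq> 0"
          using x that iid_power_nonzero[of n W as es i] by (simp add: xe S_def)
        then show ?thesis using W mem[OF that] by fastforce
      qed
      then have "v (as ! i, es ! i) > 0" if "i < n" for i
        using that assms(6) mem by blast
      then have "iid_power n v x = exp (- iid_sum n ?g x)"
        unfolding xe iid_power_def iid_sum_def by (simp add: exp_sum sum_negf)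
      then show ?thesis using x by (simp add: S_def T_def)
    qed
    moreover have "exp (- (real n * (D + \<gamma>))) / 2 \<le> sum (iid_power n P) S"
    proof -
      have "exp (- (real n * (D + \<gamma>))) / 2 \<le> (\<Sum>x\<in>S. iid_power n W x * exp (- (real n * (D + \<gamma>))))"
        using elim ST by (simp add: T_def sum_distrib_right[symmetric])
      also have "\<dots> \<le> (\<Sum>x\<in>S. iid_power n P x)"
      proof (intro sum_mono)
        fix x assume x: "x \<in> S"
        have "iid_power n W x * exp (- (real n * (D + \<gamma>))) \<le> iid_power n W x * exp (- iid_sum n ?f x)"
          using x Wn[of x] by (intro mult_left_mono) (auto simp: S_def T_def)
        also have "\<dots> = iid_power n (\<lambda>x. W x * exp (- 1 * ?f x)) x"
          unfolding iid_power_mult_exp iid_sum_cmult by simp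
        \<comment> \<open>Letterwise the left side is \<open>P x\<close> where
          \<open>W x > 0\<close> and 0 elsewhere.\<close>
        also have "\<dots> \<le> iid_power n P x"
        proof (rule iid_power_mono)
          show "x \<in> words A n \<times> words E n" using x by (simp add: S_def T_def)
          show "\<forall>x\<in>A \<times> E. 0 \<le> W x * exp (- 1 * ?f x) \<and> W x * exp (- 1 * ?f x) \<le> P x"
          proof
            fix x assume x: "x \<in> A \<times> E"
            show "0 \<le> W x * exp (- 1 * ?f x) \<and> W x * exp (- 1 * ?f x) \<le> P x"
            proof (cases "W x = 0")
              case True
              then show ?thesis using assms(5) x by auto
            next
              case False
              then have "W x > 0" using W x by fastforce
              then show ?thesis using assms(6) x by (auto simp: exp_minus)
            qed
          qed
        qed
        finally show "iid_power n W x * exp (- (real n * (D + \<gamma>))) \<le> iid_power n P x" .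
      qed
      finally show ?thesis .
    qed
    moreover have "S \<subseteq> ?X" by (auto simp: S_def T_def)
    ultimately show ?case by blast
  qed
qed

section \<open>Tilted distributions\<close>

text \<open>\<open>W\<close> is the exponential family through \<open>P\<close> with statistic
  \<open>ln v\<close>. On the support \<open>ln (W / P)\<close> is
  \<theta>\<open>* ln v - ln Z\<close>, and its \<open>W\<close>-mean is the formula for
  \<open>D\<close>.\<close>

lemma tilting:
  fixes P v :: "'x \<Rightarrow> real" and \<theta> :: real
  assumes "finite X" "prob_dist_on X P" "\<forall>x\<in>X. 0 \<le> v x" "\<forall>x\<in>X. P x > 0 \<longrightarrow> v x > 0"
  defines "Z \<equiv> (\<Sum>x\<in>X. P x * v x powr \<theta>)"
  defines "W \<equiv> \<lambda>x. P x * v x powr \<theta> / Z"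
  defines "D \<equiv> (\<Sum>x\<in>X. W x * ln (W x / P x))"
  defines "h \<equiv> (\<Sum>x\<in>X. W x * - ln (v x))"
  shows "Z > 0" "prob_dist_on X W" "\<forall>x\<in>X. W x > 0 \<longleftrightarrow> P x > 0" "D = - ln Z - \<theta> * h" "D \<ge> 0"
proof -
  have P: "P x \<ge> 0" if "x \<in> X" for x using assms(2) that by (auto simp: prob_dist_on_def)
  have P1: "sum P X = 1" using assms(2) by (simp add: prob_dist_on_def)
  then obtain x0 where x0: "x0 \<in> X" "P x0 > 0"
    using P by (metis less_eq_real_def sum.neutral zero_neq_one)
  have nn: "P x * v x powr \<theta> \<ge> 0" if "x \<in> X" for x using P[OF that] by simp
  have "P x0 * v x0 powr \<theta> > 0" using x0 assms(4) by fastforce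
  then show Z: "Z > 0"
    unfolding Z_def using assms(1) x0 nn by (intro sum_pos2[of _ x0]) auto
  have "sum W X = 1"
    using Z unfolding W_def Z_def by (simp add: sum_divide_distrib[symmetric])
  moreover have Wnn: "W x \<ge> 0" if "x \<in> X" for x using Z nn[OF that] by (simp add: W_def)
  ultimately show W: "prob_dist_on X W" by (simp add: prob_dist_on_def)
  show WP: "\<forall>x\<in>X. W x > 0 \<longleftrightarrow> P x > 0"
    using Z assms(4) P by (fastforce simp: W_def zero_less_mult_iff zero_less_divide_iff)
  have lnW: "W x * ln (W x / P x) = - \<theta> * (W x * - ln (v x)) - W x * ln Z" if x: "x \<in> X" for x
  proof (cases "P x > 0")
    case True
    then have v: "v x > 0" using assms(4) x by simp
    then have "W x / P x = v x powr \<theta> / Z" using True by (simp add: W_def)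
    then show ?thesis using Z v by (simp add: ln_div ln_powr algebra_simps)
  next
    case False
    then have "W x = 0" using WP Wnn[OF x] x by fastforce
    then show ?thesis by simp
  qed
  have "D = (\<Sum>x\<in>X. - \<theta> * (W x * - ln (v x)) - W x * ln Z)"
    unfolding D_def by (intro sum.cong lnW) auto
  also have "\<dots> = - \<theta> * h - sum W X * ln Z"
    unfolding sum_subtractf h_def sum_distrib_left sum_distrib_right ..
  finally show "D = - ln Z - \<theta> * h" using \<open>sum W X = 1\<close> by simp
  \<comment> \<open>Gibbs' inequality term by term; summation gives \<open>D \<ge> 0\<close> because
    \<open>W\<close> and \<open>P\<close> have equal mass.\<close>
  have "W x - P x \<le> W x * ln (W x / P x)" if x: "x \<in> X" for x
  proof (cases "P x > 0")
    case True
    then have Wx: "W x > 0" using WP x by simp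
    have "W x * ln (P x / W x) \<le> W x * (P x / W x - 1)"
      using True Wx by (intro mult_left_mono ln_le_minus_one) auto
    then show ?thesis using True Wx by (simp add: ln_div algebra_simps)
  next
    case False
    then have "W x = 0" using WP Wnn[OF x] x by fastforce
    then show ?thesis using P[OF x] by simp
  qed
  then have "(\<Sum>x\<in>X. W x - P x) \<le> D" unfolding D_def by (intro sum_mono)
  then show "D \<ge> 0" using P1 \<open>sum W X = 1\<close> by (simp add: sum_subtractf)
qed

text \<open>Either \<open>D\<close> and \<open>T\<close> balance exactly for some \<open>s\<close>, or \<open>T\<close> stays larger, and then its weight
  \<open>s / (1 + s)\<close> in the mean of the two tends to 1.  No limit of \<open>D\<close> or \<open>T\<close> at infinity is needed.\<close>

lemma balance_exponents:
  fixes D T :: "real \<Rightarrow> real"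
  assumes "continuous_on {0..} D" "continuous_on {0..} T"
    and "D 0 = 0" "\<And>s. s \<ge> 0 \<Longrightarrow> T s - D s \<le> B"
    and le: "\<And>s. s \<ge> 0 \<Longrightarrow> D s + s * T s \<le> (1 + s) * e"
    and "\<gamma> > 0"
  shows "\<exists>s\<ge>0. D s \<le> e + \<gamma> \<and> T s \<le> e + \<gamma>"
proof -
  have e: "e \<ge> 0" using le[of 0] assms(3) by simp
  show ?thesis
  proof (cases "\<exists>s\<ge>0. T s \<le> D s")
    case True
    then obtain s where s: "s \<ge> 0" "T s \<le> D s" by blast
    show ?thesis
    \<comment> \<open>If \<open>T 0 \<le> 0\<close>, then \<open>s = 0\<close> already works;
      otherwise \<open>D - T\<close> is negative at 0 and nonnegative at \<open>s\<close>, so it has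
      a zero \<open>u\<close> in between.\<close>
    proof (cases "T 0 \<le> 0")
      case True
      then show ?thesis using e assms(3,6) by (intro exI[of _ 0]) auto
    next
      case False
      have "continuous_on {0..s} (\<lambda>s. D s - T s)"
        using assms(1,2) by (intro continuous_on_diff) (auto intro: continuous_on_subset)
      then obtain u where u: "0 \<le> u" "D u - T u = 0"
        using IVT'[of "\<lambda>s. D s - T s" 0 0 s] s False assms(3) by auto
      then have "(1 + u) * D u \<le> (1 + u) * e" using le[of u] by (simp add: algebra_simps)
      then have "D u \<le> e" using u by simp
      then show ?thesis using u assms(6) by (intro exI[of _ u]) auto
    qed
  next
    case False
    \<comment> \<open>Chosen so that \<open>s * \<gamma>\<close> covers the bound \<open>B\<close>
      on \<open>T s - D s\<close>.\<close>
    define s where "s = max 0 B / \<gamma>"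
    have s: "s \<ge> 0" using assms(6) by (simp add: s_def)
    have s\<gamma>: "s * \<gamma> = max 0 B" using assms(6) by (simp add: s_def)
    from s have DT: "D s < T s" using False by force
    have "(1 + s) * T s = D s + s * T s + (T s - D s)" by (simp add: algebra_simps)
    also have "\<dots> \<le> (1 + s) * e + s * \<gamma>"
      using le[OF s] assms(4)[OF s] s\<gamma> by simp
    also have "\<dots> \<le> (1 + s) * (e + \<gamma>)" using assms(6) by (simp add: algebra_simps)
    finally have "T s \<le> e + \<gamma>" using s by simp
    then show ?thesis using DT s by (intro exI[of _ s]) auto
  qed
qed

text \<open>Terms with \<open>P x = 0\<close> vanish for every \<open>s\<close>, so continuity of
  \<open>v\<close> matters only on the support. \<open>D\<close> is treated through its closed form
  in \<open>tilting\<close>, which reduces it to \<open>Z\<close> and \<open>h\<close>.\<close>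

lemma continuous_on_tilting:
  fixes P :: "'x \<Rightarrow> real" and v :: "real \<Rightarrow> 'x \<Rightarrow> real" and \<theta> :: "real \<Rightarrow> real"
  assumes "finite X" "prob_dist_on X P" "continuous_on S \<theta>"
    and "\<And>s x. s \<in> S \<Longrightarrow> x \<in> X \<Longrightarrow> 0 \<le> v s x"
    and "\<And>s x. s \<in> S \<Longrightarrow> x \<in> X \<Longrightarrow> P x > 0 \<Longrightarrow> v s x > 0"
    and "\<And>x. x \<in> X \<Longrightarrow> P x > 0 \<Longrightarrow> continuous_on S (\<lambda>s. v s x)"
  defines "Z \<equiv> \<lambda>s. \<Sum>x\<in>X. P x * v s x powr \<theta> s"
  defines "h \<equiv> \<lambda>s. \<Sum>x\<in>X. P x * v s x powr \<theta> s / Z s * - ln (v s x)"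
  defines "D \<equiv> \<lambda>s. \<Sum>x\<in>X. P x * v s x powr \<theta> s / Z s * ln (P x * v s x powr \<theta> s / Z s / P x)"
  shows "continuous_on S h" "continuous_on S D"
proof -
  have Zpos: "Z s > 0" if "s \<in> S" for s
    unfolding Z_def using tilting(1)[of X P "v s"] assms(1,2,4,5) that by blast
  have cv: "continuous_on S (\<lambda>s. v s x powr \<theta> s)" if "x \<in> X" "P x > 0" for x
    using assms(3,5,6) that by (intro continuous_on_powr) fastforce+
  have Z: "continuous_on S Z"
    unfolding Z_def
  proof (intro continuous_on_sum)
    fix x assume x: "x \<in> X"
    show "continuous_on S (\<lambda>s. P x * v s x powr \<theta> s)"
    proof (cases "P x > 0")
      case True
      then show ?thesis using cv[OF x] by (intro continuous_on_mult_left)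
    next
      case False
      then have "P x = 0" using assms(2) x by (fastforce simp: prob_dist_on_def)
      then show ?thesis by simp
    qed
  qed
  show h: "continuous_on S h"
    unfolding h_def
  proof (intro continuous_on_sum)
    fix x assume x: "x \<in> X"
    show "continuous_on S (\<lambda>s. P x * v s x powr \<theta> s / Z s * - ln (v s x))"
    proof (cases "P x > 0")
      case True
      then show ?thesis using cv[OF x] assms(5,6) x Z Zpos
        by (intro continuous_on_mult continuous_on_divide continuous_on_minus continuous_on_ln
            continuous_on_const) fastforce+
    next
      case False
      then have "P x = 0" using assms(2) x by (fastforce simp: prob_dist_on_def)
      then show ?thesis by simp
    qed
  qed
  have "D s = - ln (Z s) - \<theta> s * h s" if "s \<in> S" for s
    unfolding D_def h_def Z_def using tilting(4)[of X P "v s" "\<theta> s"] assms(1,2,4,5) that by blast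
  moreover have "continuous_on S (\<lambda>s. - ln (Z s) - \<theta> s * h s)"
    using Z Zpos h assms(3)
    by (intro continuous_on_diff continuous_on_minus continuous_on_ln continuous_on_mult) force+
  ultimately show "continuous_on S D" by (simp cong: continuous_on_cong)
qed

text \<open>The lower estimate also makes \<open>\<Delta> n\<close> eventually positive, so that
  \<open>ln\<close> does not take its default value.\<close>

lemma neg_log_div_tendsto:
  fixes \<Delta> :: "nat \<Rightarrow> real"
  assumes up: "\<And>\<gamma>. \<gamma> > 0 \<Longrightarrow> \<forall>\<^sub>F n in sequentially. \<Delta> n \<le> exp (- (real n * (e - \<gamma>)))"
    and lo: "\<And>\<gamma>. \<gamma> > 0 \<Longrightarrow> \<forall>\<^sub>F n in sequentially. exp (- (real n * (e + \<gamma>))) \<le> \<Delta> n"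
  shows "(\<lambda>n. - 1 / real n * ln (\<Delta> n)) \<longlonglongrightarrow> e"
proof (rule tendstoI)
  fix \<delta> :: real
  assume "\<delta> > 0"
  then have "\<delta> / 2 > 0" by simp
  from up[OF this] lo[OF this] eventually_gt_at_top[of 0]
  show "\<forall>\<^sub>F n in sequentially. dist (- 1 / real n * ln (\<Delta> n)) e < \<delta>"
  proof eventually_elim
    case (elim n)
    have pos: "\<Delta> n > 0" using elim(2) by (meson exp_gt_zero less_le_trans)
    have "ln (\<Delta> n) \<le> - (real n * (e - \<delta> / 2))"
      using elim(1) pos by (metis ln_exp ln_mono)
    moreover have "- (real n * (e + \<delta> / 2)) \<le> ln (\<Delta> n)"
      using elim(2) pos by (metis exp_gt_zero ln_exp ln_mono)
    ultimately have "\<bar>- ln (\<Delta> n) - real n * e\<bar> \<le> real n * (\<delta> / 2)"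
      by (simp add: algebra_simps abs_if)
    moreover have "- 1 / real n * ln (\<Delta> n) - e = (- ln (\<Delta> n) - real n * e) / real n"
      using elim(3) by (simp add: field_simps)
    ultimately have "\<bar>- 1 / real n * ln (\<Delta> n) - e\<bar> \<le> \<delta> / 2"
      using elim(3) by (simp add: field_simps)
    then show ?case using \<open>\<delta> > 0\<close> by (simp add: dist_real_def)
  qed
qed

section \<open>Achievability\<close>

text \<open>A Markov-type bound: where a summand is positive, the ratio \<open>P * exp r / Q\<close>
  is at least 1, so multiplying \<open>P\<close> by its \<open>s\<close>-th power only increases
  it.\<close>

lemma excess_le_moment:
  assumes "\<forall>x\<in>A \<times> E. 0 \<le> P x \<and> 0 \<le> Q (snd x) \<and> (P x > 0 \<longrightarrow> Q (snd x) > 0)" "0 \<le> s"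
  shows "excess A E P Q r \<le> exp (r * s) * (\<Sum>x\<in>A \<times> E. P x powr (1 + s) * Q (snd x) powr (- s))"
  unfolding excess_def sum_distrib_left
proof (intro sum_mono)
  fix x assume x: "x \<in> A \<times> E"
  let ?p = "P x" and ?q = "Q (snd x)"
  show "max 0 (?p - exp (- r) * ?q) \<le> exp (r * s) * (?p powr (1 + s) * ?q powr (- s))"
  proof (cases "?p > exp (- r) * ?q")
    case True
    have q: "?q > 0" using True assms(1) x
      by (metis exp_gt_zero less_eq_real_def mult_zero_right)
    then have p: "?p > 0" using True
      by (smt (verit) exp_gt_zero mult_pos_pos)
    have "1 \<le> ?p * exp r / ?q" using True q by (simp add: exp_minus field_simps)
    then have "1 \<le> (?p * exp r / ?q) powr s" using assms(2) by (rule ge_one_powr_ge_zero)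
    then have "?p \<le> ?p * (?p * exp r / ?q) powr s" using p by simp
    also have "\<dots> = exp (r * s) * (?p powr (1 + s) * ?q powr (- s))"
      using p q by (simp add: powr_divide powr_mult powr_add powr_minus exp_powr_real field_simps)
    finally show ?thesis using q p by (auto simp: max_def intro: order_trans[rotated])
  next
    case False
    then show ?thesis by (simp add: max_def)
  qed
qed

text \<open>The moment factorizes over letters. Positivity of \<open>q\<close> on the support passes
  to words because a word of positive mass has only letters of positive mass.\<close>

lemma excess_iid_le:
  fixes P :: "'a \<times> 'e \<Rightarrow> real" and q :: "'e \<Rightarrow> real"
  assumes "\<forall>x\<in>A \<times> E. 0 \<le> P x \<and> 0 \<le> q (snd x) \<and> (P x > 0 \<longrightarrow> q (snd x) > 0)" "0 \<le> s"
  shows "excess (words A n) (words E n) (iid_power n P) (\<lambda>es. \<Prod>i<n. q (es ! i)) (real n * \<rho>)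
    \<le> exp (real n * (\<rho> * s)) * (\<Sum>x\<in>A \<times> E. P x powr (1 + s) * q (snd x) powr (- s)) ^ n"
proof -
  let ?Q = "\<lambda>es. \<Prod>i<n. q (es ! i)"
  let ?X = "words A n \<times> words E n"
  have pos: "0 \<le> iid_power n P x \<and> 0 \<le> ?Q (snd x) \<and> (iid_power n P x > 0 \<longrightarrow> ?Q (snd x) > 0)"
    if "x \<in> ?X" for x
  proof -
    obtain as es where xe: "x = (as, es)" by fastforce
    have mem: "(as ! i, es ! i) \<in> A \<times> E" if "i < n" for i
      using that \<open>x \<in> ?X\<close> nth_words_Times[of as es A n E i] xe by blast
    have Pi: "0 \<le> P (as ! i, es ! i)" "0 \<le> q (es ! i)" "P (as ! i, es ! i) > 0 \<longrightarrow> q (es ! i) > 0"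
      if "i < n" for i
      using mem[OF that] assms(1) by (metis snd_conv)+
    have "?Q es > 0" if "iid_power n P x > 0"
    proof (rule prod_pos)
      fix i assume "i \<in> {..<n}"
      then have i: "i < n" by simp
      have "P (as ! i, es ! i) \<noteq> 0"
        using that i iid_power_nonzero[of n P as es i] by (simp add: xe)
      then show "q (es ! i) > 0" using Pi[OF i] by simp
    qed
    then show ?thesis using Pi unfolding xe iid_power_def by (auto intro!: prod_nonneg)
  qed
  have "excess (words A n) (words E n) (iid_power n P) ?Q (real n * \<rho>)
    \<le> exp (real n * \<rho> * s)
        * (\<Sum>x\<in>?X. iid_power n P x powr (1 + s) * ?Q (snd x) powr (- s))"
    using pos assms(2) by (intro excess_le_moment) auto
  also have "(\<Sum>x\<in>?X. iid_power n P x powr (1 + s) * ?Q (snd x) powr (- s))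
      = (\<Sum>x\<in>?X. iid_power n (\<lambda>x. P x powr (1 + s) * q (snd x) powr (- s)) x)"
  proof (intro sum.cong refl)
    fix x assume "x \<in> ?X"
    obtain as es where xe: "x = (as, es)" by fastforce
    have mem: "(as ! i, es ! i) \<in> A \<times> E" if "i < n" for i
      using that \<open>x \<in> ?X\<close> nth_words_Times[of as es A n E i] xe by blast
    have Pi: "0 \<le> P (as ! i, es ! i)" "0 \<le> q (es ! i)" if "i < n" for i
      using mem[OF that] assms(1) by (metis snd_conv)+
    show "iid_power n P x powr (1 + s) * ?Q (snd x) powr (- s)
        = iid_power n (\<lambda>x. P x powr (1 + s) * q (snd x) powr (- s)) x"
      unfolding xe iid_power_def using Pi
      by (simp add: prod.distrib prod_powr_distrib)
  qed
  finally show ?thesis by (simp add: sum_iid_power mult.assoc)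
qed

section \<open>Converse\<close>

lemma excess_ge_subset:
  assumes "finite A" "finite E" "S \<subseteq> A \<times> E"
  shows "(\<Sum>x\<in>S. P x - exp (- r) * Q (snd x)) \<le> excess A E P Q r"
proof -
  have "(\<Sum>x\<in>S. P x - exp (- r) * Q (snd x)) \<le> (\<Sum>x\<in>S. max 0 (P x - exp (- r) * Q (snd x)))"
    by (intro sum_mono) auto
  also have "\<dots> \<le> excess A E P Q r"
    unfolding excess_def using assms by (intro sum_mono2) auto
  finally show ?thesis .
qed

lemma eventually_exp_neg_le:
  assumes "\<gamma> > 0" "c > 0"
  shows "\<forall>\<^sub>F n in sequentially. exp (- (real n * \<gamma>)) \<le> c"
  using assms by real_asymp

text \<open>The kernel \<open>v\<close> bounds the \<open>Q\<close>-mass of the typical set uniformly in \<open>Q\<close>, since each section of that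
  set has at most \<open>exp (n * (h + \<gamma>))\<close> elements.\<close>

lemma excess_iid_ge_any:
  fixes P v W :: "'a \<times> 'e \<Rightarrow> real"
  assumes "finite A" "finite E" "prob_dist_on (A \<times> E) W" "\<gamma> > 0"
    and "\<forall>x\<in>A \<times> E. 0 \<le> P x \<and> 0 \<le> v x"
    and "\<forall>x\<in>A \<times> E. W x > 0 \<longrightarrow> P x > 0 \<and> v x > 0"
    and "\<forall>e\<in>E. (\<Sum>a\<in>A. v (a, e)) \<le> 1"
  defines "D \<equiv> (\<Sum>x\<in>A \<times> E. W x * ln (W x / P x))"
  defines "h \<equiv> (\<Sum>x\<in>A \<times> E. W x * - ln (v x))"
  shows "\<forall>\<^sub>F n in sequentially. \<forall>Q. prob_dist_on (words E n) Q \<longrightarrow>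
    exp (- (real n * (D + \<gamma>))) / 4
      \<le> excess (words A n) (words E n) (iid_power n P) Q (real n * (h + D + 3 * \<gamma>))"
  using typical_set_exists[OF assms(1-6), folded D_def h_def]
    eventually_exp_neg_le[OF assms(4), of "1 / 4", simplified]
proof eventually_elim
  case (elim n)
  let ?X = "words A n \<times> words E n"
  \<comment> \<open>One \<gamma> pays for the \<open>Q\<close>-mass bound
    \<open>exp (n * (h + \<gamma>))\<close>, one matches the \<open>P\<close>-mass bound, and the
    third makes the subtracted term at most half of that bound.\<close>
  let ?r = "real n * (h + D + 3 * \<gamma>)"
  obtain S where S: "S \<subseteq> ?X" "\<forall>x\<in>S. exp (- (real n * (h + \<gamma>))) \<le> iid_power n v x"
    "exp (- (real n * (D + \<gamma>))) / 2 \<le> sum (iid_power n P) S"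
    using elim(1) by blast
  show ?case
  proof (intro allI impI)
    fix Q assume Q: "prob_dist_on (words E n) Q"
    have Qnn: "Q es \<ge> 0" if "es \<in> words E n" for es
      using Q that by (auto simp: prob_dist_on_def)
    have vn: "iid_power n v x \<ge> 0" if "x \<in> ?X" for x
      using that assms(5) by (intro iid_power_nonneg[of A E]) auto
    have fin: "finite ?X" using assms(1,2) by (simp add: finite_words)
    have "(\<Sum>x\<in>S. Q (snd x)) \<le> (\<Sum>x\<in>S. exp (real n * (h + \<gamma>)) * (iid_power n v x * Q (snd x)))"
    proof (intro sum_mono)
      fix x assume x: "x \<in> S"
      have "1 = exp (real n * (h + \<gamma>)) * exp (- (real n * (h + \<gamma>)))"
        by (simp add: exp_add[symmetric])
      also have "\<dots> \<le> exp (real n * (h + \<gamma>)) * iid_power n v x"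
        using S(2) x by (intro mult_left_mono) auto
      finally show "Q (snd x) \<le> exp (real n * (h + \<gamma>)) * (iid_power n v x * Q (snd x))"
        using mult_right_mono[of 1 "exp (real n * (h + \<gamma>)) * iid_power n v x" "Q (snd x)"]
          Qnn[of "snd x"] x S(1) by (auto simp: mult.assoc)
    qed
    also have "\<dots> \<le> (\<Sum>x\<in>?X. exp (real n * (h + \<gamma>)) * (iid_power n v x * Q (snd x)))"
      using fin S(1) vn Qnn by (intro sum_mono2) auto
    also have "\<dots> = exp (real n * (h + \<gamma>))
        * (\<Sum>es\<in>words E n. marginal_E (words A n) (iid_power n v) es * Q es)"
      unfolding sum_distrib_left[symmetric] marginal_E_def sum_distrib_right
      by (subst sum.swap) (simp add: sum.cartesian_product case_prod_unfold)
    also have "(\<Sum>es\<in>words E n. marginal_E (words A n) (iid_power n v) es * Q es)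
        \<le> (\<Sum>es\<in>words E n. 1 * Q es)"
    proof (intro sum_mono mult_right_mono Qnn)
      fix es assume es: "es \<in> words E n"
      show "marginal_E (words A n) (iid_power n v) es \<le> 1"
        unfolding marginal_iid_power
      proof (intro prod_le_1 conjI)
        fix i assume "i \<in> {..<n}"
        then have i: "es ! i \<in> E" using es nth_words by auto
        then show "0 \<le> marginal_E A v (es ! i)"
          unfolding marginal_E_def using assms(5) by (intro sum_nonneg) auto
        show "marginal_E A v (es ! i) \<le> 1"
          unfolding marginal_E_def using assms(7) i by auto
      qed
    qed auto
    also have "(\<Sum>es\<in>words E n. 1 * Q es) = 1" using Q by (simp add: prob_dist_on_def)
    finally have "exp (- ?r) * (\<Sum>x\<in>S. Q (snd x)) \<le> exp (- ?r) * exp (real n * (h + \<gamma>))"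
      by (intro mult_left_mono) auto
    also have "\<dots> = exp (- (real n * (D + \<gamma>))) * exp (- (real n * \<gamma>))"
      by (simp add: exp_add[symmetric] algebra_simps)
    also have "\<dots> \<le> exp (- (real n * (D + \<gamma>))) * (1 / 4)"
      using elim(2) by (intro mult_left_mono) auto
    finally have "exp (- (real n * (D + \<gamma>))) / 4 \<le> (\<Sum>x\<in>S. iid_power n P x - exp (- ?r) * Q (snd x))"
      using S(3) by (simp add: sum_subtractf sum_distrib_left[symmetric])
    also have "\<dots> \<le> excess (words A n) (words E n) (iid_power n P) Q ?r"
      using assms(1,2) S(1) by (intro excess_ge_subset) (auto simp: finite_words)
    finally show "exp (- (real n * (D + \<gamma>))) / 4
      \<le> excess (words A n) (words E n) (iid_power n P) Q ?r" .
  qed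
qed

text \<open>With \<open>P = v * q\<close> the comparison is pointwise: on a typical word the product
  of the \<open>q\<close>-values is at most \<open>exp (n * (h + \<gamma>))\<close> times the
  \<open>P\<close>-mass. No bound on the total mass of \<open>Q\<close> enters, hence
  \<open>D\<close> is absent from the threshold.\<close>

lemma excess_iid_ge_matched:
  fixes P v W :: "'a \<times> 'e \<Rightarrow> real" and q :: "'e \<Rightarrow> real"
  assumes "finite A" "finite E" "prob_dist_on (A \<times> E) W" "\<gamma> > 0"
    and "\<forall>x\<in>A \<times> E. 0 \<le> P x \<and> 0 \<le> v x"
    and "\<forall>x\<in>A \<times> E. W x > 0 \<longrightarrow> P x > 0 \<and> v x > 0"
    and q: "\<forall>e\<in>E. 0 \<le> q e" "\<forall>x\<in>A \<times> E. P x = v x * q (snd x)"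
  defines "D \<equiv> (\<Sum>x\<in>A \<times> E. W x * ln (W x / P x))"
  defines "h \<equiv> (\<Sum>x\<in>A \<times> E. W x * - ln (v x))"
  shows "\<forall>\<^sub>F n in sequentially. exp (- (real n * (D + \<gamma>))) / 4
      \<le> excess (words A n) (words E n) (iid_power n P) (\<lambda>es. \<Prod>i<n. q (es ! i))
          (real n * (h + 2 * \<gamma>))"
  using typical_set_exists[OF assms(1-6), folded D_def h_def]
    eventually_exp_neg_le[OF assms(4), of "1 / 2", simplified]
proof eventually_elim
  case (elim n)
  let ?X = "words A n \<times> words E n"
  let ?Q = "\<lambda>es. \<Prod>i<n. q (es ! i)"
  let ?r = "real n * (h + 2 * \<gamma>)"
  obtain S where S: "S \<subseteq> ?X" "\<forall>x\<in>S. exp (- (real n * (h + \<gamma>))) \<le> iid_power n v x"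
    "exp (- (real n * (D + \<gamma>))) / 2 \<le> sum (iid_power n P) S"
    using elim(1) by blast
  have "iid_power n P x / 2 \<le> iid_power n P x - exp (- ?r) * ?Q (snd x)" if x: "x \<in> S" for x
  proof -
    obtain as es where xe: "x = (as, es)" by fastforce
    have mem: "(as ! i, es ! i) \<in> A \<times> E" if "i < n" for i
      using that x S(1) nth_words_Times[of as es A n E i] xe by blast
    then have Q0: "?Q es \<ge> 0" using q(1) by (intro prod_nonneg) auto
    have P0: "iid_power n P x \<ge> 0"
      using x S(1) assms(5) by (intro iid_power_nonneg[of A E]) auto
    have PvQ: "iid_power n P x = iid_power n v x * ?Q es"
      unfolding xe iid_power_def prod.case prod.distrib[symmetric]
      using q(2) mem by (intro prod.cong) auto
    have "exp (- ?r) * ?Q es = exp (- (real n * \<gamma>)) * (exp (- (real n * (h + \<gamma>))) * ?Q es)"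
      by (simp add: exp_add[symmetric] algebra_simps)
    also have "\<dots> \<le> exp (- (real n * \<gamma>)) * iid_power n P x"
      unfolding PvQ using S(2) x Q0 by (intro mult_left_mono mult_right_mono) auto
    also have "\<dots> \<le> 1 / 2 * iid_power n P x"
      using elim(2) P0 by (intro mult_right_mono) auto
    finally show ?thesis by (simp add: xe)
  qed
  then have "(\<Sum>x\<in>S. iid_power n P x / 2) \<le> (\<Sum>x\<in>S. iid_power n P x - exp (- ?r) * ?Q (snd x))"
    by (intro sum_mono)
  also have "\<dots> \<le> excess (words A n) (words E n) (iid_power n P) ?Q ?r"
    using assms(1,2) S(1) by (intro excess_ge_subset) (auto simp: finite_words)
  finally show ?case using S(3) by (simp add: sum_divide_distrib[symmetric])
qed

section \<open>The exponent of \<open>Delta_I_min\<close>\<close>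

definition cond_prob :: "'a set \<Rightarrow> ('a \<times> 'e \<Rightarrow> real) \<Rightarrow> 'a \<times> 'e \<Rightarrow> real" where
  "cond_prob A P x = P x / marginal_E A P (snd x)"

text \<open>Written as the normalizer \<open>Z\<close> of \<open>tilting\<close> with
  \<open>v = cond_prob A P\<close> and exponent \<open>s\<close>.\<close>

definition down_moment :: "'a set \<Rightarrow> 'e set \<Rightarrow> ('a \<times> 'e \<Rightarrow> real) \<Rightarrow> real \<Rightarrow> real" where
  "down_moment A E P s = (\<Sum>x\<in>A \<times> E. P x * cond_prob A P x powr s)"

lemma marginal_E_ge:
  assumes "finite A" "prob_dist_on (A \<times> E) P" "x \<in> A \<times> E"
  shows "P x \<le> marginal_E A P (snd x)"
  using assms member_le_sum[of "fst x" A "\<lambda>a. P (a, snd x)"]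
  by (auto simp: marginal_E_def prob_dist_on_def)

lemma down_moment_term:
  assumes "finite A" "prob_dist_on (A \<times> E) P" "x \<in> A \<times> E"
  shows "P x powr (1 + s) * marginal_E A P (snd x) powr (- s) = P x * cond_prob A P x powr s"
proof (cases "P x > 0")
  case True
  then have "marginal_E A P (snd x) > 0" using marginal_E_ge[OF assms] by simp
  then show ?thesis
    using True by (simp add: cond_prob_def powr_add powr_divide powr_minus field_simps)
next
  case False
  then have "P x = 0" using assms(2,3) by (fastforce simp: prob_dist_on_def)
  then show ?thesis by simp
qed

text \<open>Multiplication by \<open>s\<close> removes the case distinction: at \<open>s = 0\<close>
  both sides vanish, so the Shannon entropy is never evaluated.\<close>

lemma mult_H_down:
  assumes "finite A" "finite E" "prob_dist_on (A \<times> E) P"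
  shows "s * H_down A E P s = - ln (down_moment A E P s)"
proof -
  have m: "(\<Sum>a\<in>A. \<Sum>e\<in>E. P (a, e) powr (1 + s) * marginal_E A P e powr (- s)) = down_moment A E P s"
    for s
    unfolding down_moment_def sum.cartesian_product
    using down_moment_term[OF assms(1,3), of _ s] by (intro sum.cong) auto
  show ?thesis
  proof (cases "s = 0")
    case True
    \<comment> \<open>\<open>0 powr 0\<close> is 0, which is harmless because
      \<open>cond_prob\<close> vanishes only where \<open>P\<close> does.\<close>
    have "P x * cond_prob A P x powr 0 = P x" if "x \<in> A \<times> E" for x
      using marginal_E_ge[OF assms(1,3) that] assms(3) that
      by (force simp: cond_prob_def prob_dist_on_def)
    then have "down_moment A E P 0 = sum P (A \<times> E)"
      unfolding down_moment_def by (intro sum.cong) auto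
    then show ?thesis using True assms(3) by (simp add: prob_dist_on_def)
  next
    case False
    then show ?thesis by (simp add: H_down_def m)
  qed
qed

lemma cond_prob_nonneg:
  assumes "finite A" "finite E" "prob_dist_on (A \<times> E) P"
  shows "\<forall>x\<in>A \<times> E. 0 \<le> cond_prob A P x"
    and "\<forall>x\<in>A \<times> E. P x > 0 \<longrightarrow> cond_prob A P x > 0"
proof -
  show "\<forall>x\<in>A \<times> E. 0 \<le> cond_prob A P x"
    using prob_dist_on_marginal_E[OF assms] assms(3) by (auto simp: cond_prob_def prob_dist_on_def)
  show "\<forall>x\<in>A \<times> E. P x > 0 \<longrightarrow> cond_prob A P x > 0"
    using marginal_E_ge[OF assms(1,3)] by (fastforce simp: cond_prob_def)
qed

lemma prob_dist_on_pos:
  assumes "prob_dist_on X P"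
  obtains x where "x \<in> X" "P x > 0"
  using assms unfolding prob_dist_on_def by (metis less_eq_real_def sum.neutral zero_neq_one)

text \<open>One support point suffices: its term alone bounds the moment below by
  \<open>P x powr (1 + s)\<close>, which caps every exponent at \<open>- ln (P x)\<close>. Without
  such a bound the real \<open>SUP\<close> would be meaningless.\<close>

lemma e_I_bdd_above:
  assumes "finite A" "finite E" "prob_dist_on (A \<times> E) P" "R \<ge> 0"
  shows "bdd_above ((\<lambda>s. (s * H_down A E P s - s * R) / (1 + s)) ` {0..})"
proof -
  obtain x where x: "x \<in> A \<times> E" "P x > 0" using prob_dist_on_pos[OF assms(3)] by blast
  have Px: "P x \<le> 1" using prob_dist_on_le_1[OF _ assms(3) x(1)] assms(1,2) by simp
  have m: "0 < marginal_E A P (snd x)" "marginal_E A P (snd x) \<le> 1"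
    using marginal_E_ge[OF assms(1,3) x(1)] x
      prob_dist_on_le_1[OF assms(2) prob_dist_on_marginal_E[OF assms(1-3)], of "snd x"] by auto
  have "P x \<le> P x / marginal_E A P (snd x)" using x(2) m by (simp add: field_simps)
  then have c: "P x \<le> cond_prob A P x" by (simp add: cond_prob_def)
  note nn = cond_prob_nonneg[OF assms(1-3)]
  have "(s * H_down A E P s - s * R) / (1 + s) \<le> - ln (P x)" if s: "s \<ge> 0" for s
  proof -
    have "P x powr (1 + s) = P x * P x powr s" using x(2) by (simp add: powr_add)
    also have "\<dots> \<le> P x * cond_prob A P x powr s"
      using c x(2) s by (intro mult_left_mono powr_mono2) auto
    also have "\<dots> \<le> down_moment A E P s"
      unfolding down_moment_def using assms(1-3) nn x
      by (intro member_le_sum[of x]) (auto simp: prob_dist_on_def)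
    finally have "ln (P x powr (1 + s)) \<le> ln (down_moment A E P s)"
      using x(2) by (intro ln_mono) auto
    then have "s * H_down A E P s \<le> - ln (P x) * (1 + s)"
      using x(2) unfolding mult_H_down[OF assms(1-3)] by (simp add: ln_powr algebra_simps)
    moreover have "s * R \<ge> 0" using s assms(4) by simp
    ultimately show ?thesis using s by (simp add: divide_le_eq)
  qed
  then show ?thesis by (intro bdd_aboveI2[of _ _ "- ln (P x)"]) auto
qed

lemma eventually_linear_mult_exp_le_1:
  assumes "\<gamma> > 0" "b > 0" "c > 0"
  shows "\<forall>\<^sub>F n in sequentially. (b * real n + c) * exp (- (real n * \<gamma>)) \<le> 1"
  using assms by real_asymp

lemma Delta_I_min_iid_le:
  assumes "finite A" "finite E" "prob_dist_on (A \<times> E) P" "R > 0" "\<epsilon> > 0" "\<gamma> > 0"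
  shows "\<forall>\<^sub>F n in sequentially.
    Delta_I_min (words A n) (words E n) (exp (real n * R)) \<epsilon> (iid_power n P)
      \<le> exp (- (real n * (e_I A E P R - \<gamma>)))"
proof -
  have bdd: "bdd_above ((\<lambda>s. (s * H_down A E P s - s * R) / (1 + s)) ` {0..})"
    using assms by (intro e_I_bdd_above) auto
  have "e_I A E P R - \<gamma> / 2 < (SUP s\<in>{0..}. (s * H_down A E P s - s * R) / (1 + s))"
    using assms(6) by (simp add: e_I_def)
  then obtain s where s: "s \<ge> 0" "e_I A E P R - \<gamma> / 2 < (s * H_down A E P s - s * R) / (1 + s)"
    by (subst (asm) less_cSUP_iff[OF _ bdd]) auto
  define x where "x = (s * H_down A E P s - s * R) / (1 + s)"
  \<comment> \<open>This threshold balances the summands: \<open>M * exp (- r)\<close> and the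
    moment bound both become \<open>exp (- (n * x))\<close>.\<close>
  define \<rho> where "\<rho> = x + R"
  note nn = cond_prob_nonneg[OF assms(1-3)]
  have m: "\<forall>e\<in>E. 0 \<le> marginal_E A P e"
    using prob_dist_on_marginal_E[OF assms(1-3)] by (auto simp: prob_dist_on_def)
  have Zpos: "down_moment A E P s > 0"
    unfolding down_moment_def using assms(1-3) nn by (intro tilting(1)) auto
  have x: "\<rho> * s + ln (down_moment A E P s) = - x"
  proof -
    have "(1 + s) * x = - ln (down_moment A E P s) - s * R"
      using s(1) mult_H_down[OF assms(1-3)] by (simp add: x_def)
    then show ?thesis by (simp add: \<rho>_def algebra_simps)
  qed
  \<comment> \<open>The factor linear in \<open>n\<close> comes from \<open>eta_le\<close>; half of
    \<gamma> absorbs it, the other half having been spent on a near-optimal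
    \<open>s\<close>.\<close>
  have "\<forall>\<^sub>F n in sequentially. ((R + \<bar>x\<bar>) * real n + (1 + \<epsilon>)) * exp (- (real n * (\<gamma> / 2))) \<le> 1"
    using assms by (intro eventually_linear_mult_exp_le_1) auto
  then show ?thesis
  proof eventually_elim
    case (elim n)
    define u where "u = exp (- (real n * x))"
    note fin = finite_words[OF assms(1), of n] finite_words[OF assms(2), of n]
    have "excess (words A n) (words E n) (iid_power n P) (marginal_E (words A n) (iid_power n P))
        (real n * \<rho>)
      \<le> exp (real n * (\<rho> * s)) * (\<Sum>x\<in>A \<times> E. P x powr (1 + s) * marginal_E A P (snd x) powr (- s)) ^ n"
      unfolding marginal_iid_power[abs_def]
      using m s(1) assms(3) marginal_E_ge[OF assms(1,3)]
      by (intro excess_iid_le) (fastforce simp: prob_dist_on_def)+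
    also have "(\<Sum>x\<in>A \<times> E. P x powr (1 + s) * marginal_E A P (snd x) powr (- s)) = down_moment A E P s"
      unfolding down_moment_def using down_moment_term[OF assms(1,3)] by (intro sum.cong) auto
    also have "down_moment A E P s ^ n = exp (real n * ln (down_moment A E P s))"
      using Zpos by (simp add: exp_of_nat_mult)
    also have "exp (real n * (\<rho> * s)) * \<dots> = u"
      unfolding exp_add[symmetric] distrib_left[symmetric] x u_def by simp
    finally have "Delta_I_min (words A n) (words E n) (exp (real n * R)) \<epsilon> (iid_power n P)
        \<le> u * (ln (exp (real n * R)) + 1 + \<bar>ln u\<bar>) + \<epsilon> * exp (real n * R) * exp (- (real n * \<rho>))"
      using fin assms prob_dist_on_iid_power[OF assms(3), of n]
      by (intro Delta_I_min_le) (auto simp: u_def)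
    also have "\<epsilon> * exp (real n * R) * exp (- (real n * \<rho>)) = \<epsilon> * u"
      by (simp add: u_def \<rho>_def exp_add[symmetric] algebra_simps)
    also have "u * (ln (exp (real n * R)) + 1 + \<bar>ln u\<bar>) + \<epsilon> * u
        = u * ((R + \<bar>x\<bar>) * real n + (1 + \<epsilon>))"
      by (simp add: u_def abs_mult algebra_simps)
    also have "\<dots> \<le> exp (- (real n * (e_I A E P R - \<gamma> / 2))) * ((R + \<bar>x\<bar>) * real n + (1 + \<epsilon>))"
      using s(2) assms by (intro mult_right_mono) (auto simp: u_def x_def intro!: mult_left_mono add_nonneg_nonneg mult_nonneg_nonneg simp del: times_divide_eq_right)
    also have "\<dots> = exp (- (real n * (e_I A E P R - \<gamma>)))
        * (((R + \<bar>x\<bar>) * real n + (1 + \<epsilon>)) * exp (- (real n * (\<gamma> / 2))))"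
      by (simp add: exp_add[symmetric] algebra_simps)
    also have "\<dots> \<le> exp (- (real n * (e_I A E P R - \<gamma>))) * 1"
      using elim by (intro mult_left_mono) auto
    finally show ?case by simp
  qed
qed

lemma Delta_I_min_iid_ge:
  assumes "finite A" "finite E" "prob_dist_on (A \<times> E) P" "R > 0" "\<epsilon> > 0" "\<gamma> > 0"
  shows "\<forall>\<^sub>F n in sequentially. exp (- (real n * (e_I A E P R + \<gamma>)))
      \<le> Delta_I_min (words A n) (words E n) (exp (real n * R)) \<epsilon> (iid_power n P)"
proof -
  define e where "e = e_I A E P R"
  define v where "v = cond_prob A P"
  define W where "W = (\<lambda>s x. P x * v x powr s / down_moment A E P s)"
  define D where "D = (\<lambda>s. \<Sum>x\<in>A \<times> E. W s x * ln (W s x / P x))"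
  define h where "h = (\<lambda>s. \<Sum>x\<in>A \<times> E. W s x * - ln (v x))"
  have fin: "finite (A \<times> E)" using assms(1,2) by simp
  have P: "\<forall>x\<in>A \<times> E. 0 \<le> P x" using assms(3) by (auto simp: prob_dist_on_def)
  note nn = cond_prob_nonneg[OF assms(1-3), folded v_def]
  note Z_def = down_moment_def[of A E P, folded v_def]
  have tilt: "prob_dist_on (A \<times> E) (W s)" "\<forall>x\<in>A \<times> E. W s x > 0 \<longleftrightarrow> P x > 0"
    "D s = - ln (down_moment A E P s) - s * h s" "D s \<ge> 0" for s
    using tilting(2-5)[OF fin assms(3) nn, of s] unfolding D_def h_def W_def Z_def by blast+
  have cont: "continuous_on {0..} h" "continuous_on {0..} D"
    unfolding D_def h_def W_def Z_def using fin assms(3) nn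
    by (intro continuous_on_tilting[where \<theta> = "\<lambda>s. s" and v = "\<lambda>_. v"]; auto)+
  have ub: "(s * H_down A E P s - s * R) / (1 + s) \<le> e" if "s \<ge> 0" for s
    unfolding e_def e_I_def using that e_I_bdd_above[of A E P R] assms by (intro cSUP_upper) auto
  \<comment> \<open>Three \<delta> cover the balancing error and the typicality slack in both
    exponents; the fourth absorbs the constants 1/4 and \<epsilon>.\<close>
  define \<delta> where "\<delta> = \<gamma> / 4"
  have \<delta>: "\<delta> > 0" using assms(6) by (simp add: \<delta>_def)
  have "\<exists>s\<ge>0. D s \<le> e + \<delta> \<and> h s - R \<le> e + \<delta>"
  proof (rule balance_exponents[OF cont(2) _ _ _ _ \<delta>])
    show "continuous_on {0..} (\<lambda>s. h s - R)" using cont(1) by (intro continuous_on_diff) auto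
    show "D 0 = 0" using tilt(3)[of 0] mult_H_down[OF assms(1-3), of 0] by simp
    show "h s - R - D s \<le> (\<Sum>x\<in>A \<times> E. \<bar>ln (v x)\<bar>)" if "s \<ge> 0" for s
    proof -
      have "h s \<le> (\<Sum>x\<in>A \<times> E. \<bar>ln (v x)\<bar>)"
        unfolding h_def
      proof (intro sum_mono)
        fix x assume x: "x \<in> A \<times> E"
        have "0 \<le> W s x" "W s x \<le> 1"
          using tilt(1)[of s] x prob_dist_on_le_1[OF fin, of "W s" x] by (auto simp: prob_dist_on_def)
        then have "W s x * - ln (v x) \<le> 1 * \<bar>ln (v x)\<bar>"
          by (intro order_trans[OF mult_left_mono mult_right_mono]) auto
        then show "W s x * - ln (v x) \<le> \<bar>ln (v x)\<bar>" by simp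
      qed
      then show ?thesis using tilt(4)[of s] assms(4) by simp
    qed
    \<comment> \<open>By the formula for \<open>D\<close> the left side is
      \<open>- ln (down_moment A E P s) - s * R\<close>, that is, the numerator in
      \<open>e_I\<close>.\<close>
    show "D s + s * (h s - R) \<le> (1 + s) * e" if "s \<ge> 0" for s
      using ub[OF that] that mult_H_down[OF assms(1-3), of s]
      by (simp add: tilt(3) divide_le_eq algebra_simps)
  qed
  then obtain s where s: "s \<ge> 0" "D s \<le> e + \<delta>" "h s - R \<le> e + \<delta>" by blast
  have "\<forall>\<^sub>F n in sequentially. exp (- (real n * (D s + \<delta>))) / 4
      \<le> excess (words A n) (words E n) (iid_power n P) (\<lambda>es. \<Prod>i<n. marginal_E A P (es ! i))
          (real n * (h s + 2 * \<delta>))"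
    unfolding D_def h_def
  proof (rule excess_iid_ge_matched[OF assms(1,2) tilt(1)[of s] \<delta>])
    show "\<forall>x\<in>A \<times> E. 0 \<le> P x \<and> 0 \<le> v x" using P nn by auto
    show "\<forall>x\<in>A \<times> E. 0 < W s x \<longrightarrow> 0 < P x \<and> 0 < v x" using tilt(2) nn by auto
    show "\<forall>e\<in>E. 0 \<le> marginal_E A P e"
      using prob_dist_on_marginal_E[OF assms(1-3)] by (auto simp: prob_dist_on_def)
    show "\<forall>x\<in>A \<times> E. P x = v x * marginal_E A P (snd x)"
      using marginal_E_ge[OF assms(1,3)] P by (fastforce simp: v_def cond_prob_def)
  qed
  moreover have "\<forall>\<^sub>F n in sequentially. exp (- (real n * \<delta>)) \<le> min (1 / 4) \<epsilon>"
    using \<delta> assms(5) by (intro eventually_exp_neg_le) auto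
  \<comment> \<open>Supplies the requirement \<open>M \<ge> exp 1\<close> of
    \<open>Delta_I_min_ge\<close>.\<close>
  moreover have "\<forall>\<^sub>F n in sequentially. 1 \<le> real n * R"
    using assms(4) by real_asymp
  ultimately show ?thesis
  proof eventually_elim
    case (elim n)
    let ?\<Delta> = "Delta_I_min (words A n) (words E n) (exp (real n * R)) \<epsilon> (iid_power n P)"
    have "min (exp (- (real n * (D s + \<delta>))) / 4)
        (\<epsilon> * exp (real n * R) * exp (- (real n * (h s + 2 * \<delta>)))) \<le> ?\<Delta>"
      using elim finite_words[OF assms(1)] finite_words[OF assms(2)] assms(5)
        prob_dist_on_iid_power[OF assms(3), of n]
      by (intro Delta_I_min_ge) (auto simp: marginal_iid_power[abs_def])
    moreover have "exp (- (real n * (e + \<gamma>))) \<le> exp (- (real n * (D s + \<delta>))) / 4"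
    proof -
      have "exp (- (real n * (e + \<gamma>))) = exp (- (real n * (e + 3 * \<delta>))) * exp (- (real n * \<delta>))"
        by (simp add: \<delta>_def exp_add[symmetric] algebra_simps)
      also have "\<dots> \<le> exp (- (real n * (D s + \<delta>))) * (1 / 4)"
        using elim(2) s(2) \<delta> by (intro mult_mono) (auto intro!: mult_left_mono)
      finally show ?thesis by simp
    qed
    moreover have "exp (- (real n * (e + \<gamma>)))
        \<le> \<epsilon> * exp (real n * R) * exp (- (real n * (h s + 2 * \<delta>)))"
    proof -
      have "exp (- (real n * (e + \<gamma>))) = exp (- (real n * \<delta>)) * exp (- (real n * (e + 3 * \<delta>)))"
        by (simp add: \<delta>_def exp_add[symmetric] algebra_simps)
      also have "\<dots> \<le> \<epsilon> * exp (- (real n * (h s - R + 2 * \<delta>)))"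
        using elim(2) s(3) \<delta> assms(5) by (intro mult_mono) (auto intro!: mult_left_mono)
      also have "\<dots> = \<epsilon> * exp (real n * R) * exp (- (real n * (h s + 2 * \<delta>)))"
        by (simp add: exp_add[symmetric] algebra_simps)
      finally show ?thesis .
    qed
    ultimately show ?case by (simp add: e_def)
  qed
qed

section \<open>The exponent of \<open>Delta_d_min\<close>\<close>

definition power_marginal :: "'a set \<Rightarrow> ('a \<times> 'e \<Rightarrow> real) \<Rightarrow> real \<Rightarrow> 'e \<Rightarrow> real" where
  "power_marginal A P s e = (\<Sum>a\<in>A. P (a, e) powr (1 + s))"

text \<open>For each \<open>e\<close> of positive \<open>power_marginal\<close>, the escort
  distribution of order \<open>1 + s\<close> on \<open>A\<close>. Unlike \<open>cond_prob\<close> it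
  varies with \<open>s\<close>.\<close>

definition escort_prob :: "'a set \<Rightarrow> ('a \<times> 'e \<Rightarrow> real) \<Rightarrow> real \<Rightarrow> 'a \<times> 'e \<Rightarrow> real" where
  "escort_prob A P s x = P x powr (1 + s) / power_marginal A P s (snd x)"

definition up_moment :: "'a set \<Rightarrow> 'e set \<Rightarrow> ('a \<times> 'e \<Rightarrow> real) \<Rightarrow> real \<Rightarrow> real" where
  "up_moment A E P s = (\<Sum>e\<in>E. power_marginal A P s e powr (1 / (1 + s)))"

lemma power_marginal_nonneg: "0 \<le> power_marginal A P s e"
  by (simp add: power_marginal_def sum_nonneg)

lemma power_marginal_ge:
  assumes "finite A" "x \<in> A \<times> E"
  shows "P x powr (1 + s) \<le> power_marginal A P s (snd x)"
  using assms member_le_sum[of "fst x" A "\<lambda>a. P (a, snd x) powr (1 + s)"]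
  by (auto simp: power_marginal_def)

lemma escort_prob_bounds:
  assumes "finite A" "x \<in> A \<times> E"
  shows "0 \<le> escort_prob A P s x" "escort_prob A P s x \<le> 1"
    "P x > 0 \<Longrightarrow> escort_prob A P s x > 0"
proof -
  note ge = power_marginal_ge[OF assms, of P s]
  show "0 \<le> escort_prob A P s x"
    by (simp add: escort_prob_def power_marginal_nonneg)
  show "escort_prob A P s x \<le> 1"
    using ge power_marginal_nonneg[of A P s "snd x"] by (auto simp: escort_prob_def divide_le_eq_1)
  show "escort_prob A P s x > 0" if "P x > 0"
  proof -
    have "P x powr (1 + s) > 0" using that by simp
    moreover from this have "power_marginal A P s (snd x) > 0" using ge by linarith
    ultimately show ?thesis unfolding escort_prob_def by (rule divide_pos_pos)
  qed
qed

text \<open>The sum is 0 rather than 1 where \<open>power_marginal\<close> vanishes, hence only an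
  inequality.\<close>

lemma sum_escort_prob_le: "(\<Sum>a\<in>A. escort_prob A P s (a, e)) \<le> 1"
proof -
  have "(\<Sum>a\<in>A. escort_prob A P s (a, e)) = power_marginal A P s e / power_marginal A P s e"
    by (simp add: escort_prob_def power_marginal_def sum_divide_distrib[symmetric])
  then show ?thesis by simp
qed

text \<open>The first form is, up to normalization, a summand of the moment with the optimal
  \<open>Q\<close>, as used in achievability. The second sums over \<open>a\<close> to the terms of
  \<open>up_moment\<close> and bounds the tilted law in the converse.\<close>

lemma escort_tilt_term:
  assumes "finite A" "prob_dist_on (A \<times> E) P" "x \<in> A \<times> E" "s \<ge> 0"
  shows "P x * escort_prob A P s x powr (s / (1 + s))
    = P x powr (1 + s) * (power_marginal A P s (snd x) powr (1 / (1 + s))) powr (- s)"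
    and "P x * escort_prob A P s x powr (s / (1 + s))
    = escort_prob A P s x * power_marginal A P s (snd x) powr (1 / (1 + s))"
proof -
  let ?K = "power_marginal A P s (snd x)"
  have "P x * escort_prob A P s x powr (s / (1 + s)) = P x powr (1 + s) * (?K powr (1 / (1 + s))) powr (- s)
    \<and> P x * escort_prob A P s x powr (s / (1 + s)) = escort_prob A P s x * ?K powr (1 / (1 + s))"
  proof (cases "P x > 0")
    case True
    have "P x powr (1 + s) > 0" using True by simp
    then have K: "?K > 0" using power_marginal_ge[OF assms(1,3), of P s] by linarith
    have "P x * escort_prob A P s x powr (s / (1 + s))
        = P x * (P x powr s * ?K powr (- (s / (1 + s))))"
      using True K assms(4)
      by (simp add: escort_prob_def powr_divide powr_powr powr_minus_divide)
    moreover have "?K powr (- (s / (1 + s))) = ?K powr (1 / (1 + s)) / ?K"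
    proof -
      have "- (s / (1 + s)) = 1 / (1 + s) - 1" using assms(4) by (simp add: field_simps)
      then show ?thesis using K by (simp add: powr_diff)
    qed
    ultimately show ?thesis using True K
      by (auto simp: escort_prob_def powr_powr powr_add)
  next
    case False
    then have "P x = 0" using assms(2,3) by (fastforce simp: prob_dist_on_def)
    then show ?thesis by (simp add: escort_prob_def)
  qed
  then show "P x * escort_prob A P s x powr (s / (1 + s))
    = P x powr (1 + s) * (?K powr (1 / (1 + s))) powr (- s)"
    and "P x * escort_prob A P s x powr (s / (1 + s)) = escort_prob A P s x * ?K powr (1 / (1 + s))"
    by auto
qed

text \<open>Presents \<open>up_moment\<close> as the normalizer of \<open>tilting\<close> with
  \<open>v = escort_prob A P s\<close> and exponent \<open>s / (1 + s)\<close>.\<close>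

lemma up_moment_altdef:
  assumes "finite A" "finite E" "prob_dist_on (A \<times> E) P" "s \<ge> 0"
  shows "up_moment A E P s = (\<Sum>x\<in>A \<times> E. P x * escort_prob A P s x powr (s / (1 + s)))"
proof -
  let ?K = "power_marginal A P s"
  have "(\<Sum>x\<in>A \<times> E. P x * escort_prob A P s x powr (s / (1 + s)))
      = (\<Sum>x\<in>A \<times> E. escort_prob A P s x * ?K (snd x) powr (1 / (1 + s)))"
    using escort_tilt_term(2)[OF assms(1,3) _ assms(4)] by (intro sum.cong) auto
  also have "\<dots> = (\<Sum>e\<in>E. \<Sum>a\<in>A. escort_prob A P s (a, e) * ?K e powr (1 / (1 + s)))"
    by (subst sum.swap) (simp add: sum.cartesian_product case_prod_unfold)
  also have "\<dots> = (\<Sum>e\<in>E. ?K e powr (1 / (1 + s)))"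
  proof (intro sum.cong refl)
    fix e
    \<comment> \<open>The quotient is 1, or 0 where \<open>?K e = 0\<close>; there the remaining
      factor \<open>0 powr _\<close> is 0 as well.\<close>
    have "(\<Sum>a\<in>A. escort_prob A P s (a, e)) = ?K e / ?K e"
      by (simp add: escort_prob_def power_marginal_def sum_divide_distrib[symmetric])
    then have "(\<Sum>a\<in>A. escort_prob A P s (a, e) * ?K e powr (1 / (1 + s)))
        = ?K e / ?K e * ?K e powr (1 / (1 + s))"
      by (simp only: sum_distrib_right[symmetric])
    then show "(\<Sum>a\<in>A. escort_prob A P s (a, e) * ?K e powr (1 / (1 + s))) = ?K e powr (1 / (1 + s))"
      by auto
  qed
  finally show ?thesis by (simp add: up_moment_def)
qed

lemma up_moment_pos:
  assumes "finite A" "finite E" "prob_dist_on (A \<times> E) P" "s \<ge> 0"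
  shows "up_moment A E P s > 0"
  unfolding up_moment_altdef[OF assms]
  using assms escort_prob_bounds[OF assms(1), of _ E P s] by (intro tilting(1)) auto

lemma up_moment_0:
  assumes "finite A" "finite E" "prob_dist_on (A \<times> E) P"
  shows "up_moment A E P 0 = 1"
proof -
  have "P x * escort_prob A P 0 x powr 0 = P x" if "x \<in> A \<times> E" for x
    using escort_prob_bounds(3)[OF assms(1) that, of P 0] assms(3) that
    by (force simp: prob_dist_on_def)
  then have "up_moment A E P 0 = sum P (A \<times> E)"
    unfolding up_moment_altdef[OF assms order_refl] by (intro sum.cong) auto
  then show ?thesis using assms(3) by (simp add: prob_dist_on_def)
qed

lemma mult_H_up:
  assumes "finite A" "finite E" "prob_dist_on (A \<times> E) P" "s \<ge> 0"
  shows "s * H_up A E P s = - (1 + s) * ln (up_moment A E P s)"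
proof (cases "s = 0")
  case True
  then show ?thesis using up_moment_0[OF assms(1-3)] by simp
next
  case False
  then have "s * (- ((1 + s) / s) * c) = - (1 + s) * c" for c :: real
    by (simp add: field_simps)
  with False show ?thesis
    unfolding H_up_def up_moment_def power_marginal_def by (simp only: if_False)
qed

lemma e_d_bdd_above:
  assumes "finite A" "finite E" "prob_dist_on (A \<times> E) P" "R \<ge> 0"
  shows "bdd_above ((\<lambda>s. s * (H_up A E P s - R) / (1 + 2 * s)) ` {0..})"
proof -
  obtain x where x: "x \<in> A \<times> E" "P x > 0" using prob_dist_on_pos[OF assms(3)] by blast
  have Px: "P x \<le> 1" using prob_dist_on_le_1[OF _ assms(3) x(1)] assms(1,2) by simp
  have "s * (H_up A E P s - R) / (1 + 2 * s) \<le> - ln (P x)" if s: "s \<ge> 0" for s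
  proof -
    have "P x = (P x powr (1 + s)) powr (1 / (1 + s))"
      using x(2) s by (simp add: powr_powr)
    also have "\<dots> \<le> power_marginal A P s (snd x) powr (1 / (1 + s))"
      using power_marginal_ge[OF assms(1) x(1), of P s] s by (intro powr_mono2) auto
    also have "\<dots> \<le> up_moment A E P s"
      unfolding up_moment_def using assms(2) x(1) by (intro member_le_sum) auto
    finally have "ln (P x) \<le> ln (up_moment A E P s)"
      using x(2) by (intro ln_mono) auto
    then have "(1 + s) * ln (P x) \<le> (1 + s) * ln (up_moment A E P s)"
      using s by (intro mult_left_mono) auto
    moreover have "s * ln (P x) \<le> 0" using s Px x(2) by (intro mult_nonneg_nonpos) auto
    moreover have "s * R \<ge> 0" using s assms(4) by simp
    ultimately have "s * (H_up A E P s - R) \<le> - ln (P x) * (1 + 2 * s)"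
      using mult_H_up[OF assms(1-3) s] by (simp add: algebra_simps)
    then show ?thesis using s by (simp add: divide_le_eq)
  qed
  then show ?thesis by (intro bdd_aboveI2[of _ _ "- ln (P x)"]) auto
qed

lemma Delta_d_min_iid_le:
  assumes "finite A" "finite E" "prob_dist_on (A \<times> E) P" "R > 0" "\<epsilon> > 0" "\<gamma> > 0"
  shows "\<forall>\<^sub>F n in sequentially.
    Delta_d_min (words A n) (words E n) (exp (real n * R)) \<epsilon> (iid_power n P)
      \<le> exp (- (real n * (e_d A E P R - \<gamma>)))"
proof -
  have bdd: "bdd_above ((\<lambda>s. s * (H_up A E P s - R) / (1 + 2 * s)) ` {0..})"
    using assms by (intro e_d_bdd_above) auto
  have "e_d A E P R - \<gamma> / 2 < (SUP s\<in>{0..}. s * (H_up A E P s - R) / (1 + 2 * s))"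
    using assms(6) by (simp add: e_d_def)
  then obtain s where s: "s \<ge> 0" "e_d A E P R - \<gamma> / 2 < s * (H_up A E P s - R) / (1 + 2 * s)"
    by (subst (asm) less_cSUP_iff[OF _ bdd]) auto
  define x where "x = s * (H_up A E P s - R) / (1 + 2 * s)"
  define Z where "Z = up_moment A E P s"
  \<comment> \<open>The second summand of \<open>Delta_d_min\<close> has exponent half of
    \<rho>\<open>- R\<close>, so this choice gives \<open>x\<close>; the moment bound with
    \<open>q\<close> below then has exponent \<open>x\<close> too.\<close>
  define \<rho> where "\<rho> = 2 * x + R"
  define q where "q = (\<lambda>e. power_marginal A P s e powr (1 / (1 + s)) / Z)"
  have Z: "Z > 0" unfolding Z_def using up_moment_pos[OF assms(1-3) s(1)] .
  have q: "prob_dist_on E q"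
    using Z by (simp add: prob_dist_on_def q_def sum_divide_distrib[symmetric] Z_def up_moment_def)
  have x: "\<rho> * s + (1 + s) * ln Z = - x"
  proof -
    have "(1 + 2 * s) * x = s * (H_up A E P s - R)" using s(1) by (simp add: x_def)
    then have "(1 + 2 * s) * x = - (1 + s) * ln Z - s * R"
      using mult_H_up[OF assms(1-3) s(1)] by (simp add: Z_def algebra_simps)
    then show ?thesis by (simp add: \<rho>_def algebra_simps)
  qed
  have moment: "(\<Sum>x\<in>A \<times> E. P x powr (1 + s) * q (snd x) powr (- s)) = exp ((1 + s) * ln Z)"
  proof -
    have "P x powr (1 + s) * q (snd x) powr (- s)
        = P x * escort_prob A P s x powr (s / (1 + s)) * Z powr s" if "x \<in> A \<times> E" for x
      unfolding escort_tilt_term(1)[OF assms(1,3) that s(1)] q_def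
      using Z by (simp add: powr_divide powr_minus_divide)
    then have "(\<Sum>x\<in>A \<times> E. P x powr (1 + s) * q (snd x) powr (- s)) = Z * Z powr s"
      unfolding Z_def up_moment_altdef[OF assms(1-3) s(1)] sum_distrib_right
      by (intro sum.cong) auto
    also have "\<dots> = Z powr (1 + s)" using Z by (simp add: powr_add)
    finally show ?thesis using Z by (simp add: powr_def)
  qed
  have P: "\<forall>x\<in>A \<times> E. 0 \<le> P x \<and> 0 \<le> q (snd x) \<and> (P x > 0 \<longrightarrow> q (snd x) > 0)"
  proof
    fix x assume x: "x \<in> A \<times> E"
    have "q (snd x) > 0" if "P x > 0"
    proof -
      have "P x powr (1 + s) > 0" using that by simp
      then have "power_marginal A P s (snd x) > 0"
        using power_marginal_ge[OF assms(1) x, of P s] by linarith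
      then show ?thesis using Z by (simp add: q_def)
    qed
    then show "0 \<le> P x \<and> 0 \<le> q (snd x) \<and> (P x > 0 \<longrightarrow> q (snd x) > 0)"
      using x assms(3) q by (auto simp: prob_dist_on_def)
  qed
  \<comment> \<open>Without \<open>eta\<close> only the constant \<open>2 + sqrt \<epsilon>\<close>
    has to be absorbed.\<close>
  have "\<forall>\<^sub>F n in sequentially. exp (- (real n * (\<gamma> / 2))) \<le> 1 / (2 + sqrt \<epsilon>)"
    using assms by (intro eventually_exp_neg_le) (auto intro: add_pos_nonneg)
  then show ?thesis
  proof eventually_elim
    case (elim n)
    define u where "u = exp (- (real n * x))"
    note fin = finite_words[OF assms(1), of n] finite_words[OF assms(2), of n]
    let ?Q = "\<lambda>es. \<Prod>i<n. q (es ! i)"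
    have "excess (words A n) (words E n) (iid_power n P) ?Q (real n * \<rho>)
      \<le> exp (real n * (\<rho> * s)) * exp ((1 + s) * ln Z) ^ n"
      using excess_iid_le[OF P s(1)] unfolding moment .
    also have "exp ((1 + s) * ln Z) ^ n = exp (real n * ((1 + s) * ln Z))"
      by (simp only: exp_of_nat_mult)
    also have "exp (real n * (\<rho> * s)) * \<dots> = u"
      unfolding exp_add[symmetric] distrib_left[symmetric] x u_def by simp
    finally have ex: "excess (words A n) (words E n) (iid_power n P) ?Q (real n * \<rho>) \<le> u" .
    have "Delta_d_min (words A n) (words E n) (exp (real n * R)) \<epsilon> (iid_power n P)
        \<le> 2 * excess (words A n) (words E n) (iid_power n P) ?Q (real n * \<rho>)
          + sqrt \<epsilon> * exp (real n * R) powr (1 / 2) * exp (- (real n * \<rho>) / 2)"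
      using fin assms prob_dist_on_iid_power[OF assms(3), of n] prob_dist_on_words[OF q, of n]
      by (intro Delta_d_min_le) auto
    also have "sqrt \<epsilon> * exp (real n * R) powr (1 / 2) * exp (- (real n * \<rho>) / 2) = sqrt \<epsilon> * u"
      by (simp add: u_def \<rho>_def exp_powr_real mult.assoc exp_add[symmetric] field_simps)
    also have "2 * excess (words A n) (words E n) (iid_power n P) ?Q (real n * \<rho>) + sqrt \<epsilon> * u
        \<le> u * (2 + sqrt \<epsilon>)"
      using ex by (simp add: algebra_simps)
    also have "\<dots> \<le> exp (- (real n * (e_d A E P R - \<gamma> / 2))) * (2 + sqrt \<epsilon>)"
    proof (rule mult_right_mono)
      have "real n * (e_d A E P R - \<gamma> / 2) \<le> real n * x"
        using s(2) by (intro mult_left_mono) (auto simp: x_def)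
      then show "u \<le> exp (- (real n * (e_d A E P R - \<gamma> / 2)))" by (simp add: u_def)
    qed (use assms(5) in auto)
    also have "\<dots> = exp (- (real n * (e_d A E P R - \<gamma>)))
        * (exp (- (real n * (\<gamma> / 2))) * (2 + sqrt \<epsilon>))"
      by (simp add: exp_add[symmetric] algebra_simps)
    also have "\<dots> \<le> exp (- (real n * (e_d A E P R - \<gamma>))) * 1"
    proof (rule mult_left_mono)
      have "0 < 2 + sqrt \<epsilon>" using assms(5) by (intro add_pos_nonneg) auto
      then show "exp (- (real n * (\<gamma> / 2))) * (2 + sqrt \<epsilon>) \<le> 1"
        using elim by (simp add: pos_le_divide_eq)
    qed auto
    finally show ?case by simp
  qed
qed

lemma Delta_d_min_iid_ge:
  assumes "finite A" "finite E" "prob_dist_on (A \<times> E) P" "R > 0" "\<epsilon> > 0" "\<gamma> > 0"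
  shows "\<forall>\<^sub>F n in sequentially. exp (- (real n * (e_d A E P R + \<gamma>)))
      \<le> Delta_d_min (words A n) (words E n) (exp (real n * R)) \<epsilon> (iid_power n P)"
proof -
  define e where "e = e_d A E P R"
  define v where "v = escort_prob A P"
  define Z where "Z = (\<lambda>s. \<Sum>x\<in>A \<times> E. P x * v s x powr (s / (1 + s)))"
  define W where "W = (\<lambda>s x. P x * v s x powr (s / (1 + s)) / Z s)"
  define D where "D = (\<lambda>s. \<Sum>x\<in>A \<times> E. W s x * ln (W s x / P x))"
  define h where "h = (\<lambda>s. \<Sum>x\<in>A \<times> E. W s x * - ln (v s x))"
  have fin: "finite (A \<times> E)" using assms(1,2) by simp
  have P: "0 \<le> P x" if "x \<in> A \<times> E" for x using assms(3) that by (auto simp: prob_dist_on_def)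
  have v: "0 \<le> v s x" "v s x \<le> 1" "P x > 0 \<Longrightarrow> v s x > 0" if "x \<in> A \<times> E" for s x
    using escort_prob_bounds[OF assms(1) that] by (auto simp: v_def)
  have ZU: "Z s = up_moment A E P s" if "s \<ge> 0" for s
    using up_moment_altdef[OF assms(1-3) that] by (simp add: Z_def v_def)
  have tilt: "prob_dist_on (A \<times> E) (W s)" "\<forall>x\<in>A \<times> E. W s x > 0 \<longleftrightarrow> P x > 0"
    "D s = - ln (Z s) - s / (1 + s) * h s" "D s \<ge> 0" for s
    using tilting(2-5)[OF fin assms(3), of "v s" "s / (1 + s)"] v
    unfolding D_def h_def W_def Z_def by blast+
  have contv: "continuous_on {0..} (\<lambda>s. v s x)" if x: "x \<in> A \<times> E" "P x > 0" for x
  proof -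
    have pw: "continuous_on {0..} (\<lambda>s. P y powr (1 + s))" if "y \<in> A \<times> E" for y
    proof (cases "P y = 0")
      case False
      then show ?thesis by (intro continuous_intros) auto
    qed simp
    have "continuous_on {0..} (\<lambda>s. power_marginal A P s (snd x))"
      unfolding power_marginal_def using pw x(1) by (intro continuous_on_sum) auto
    moreover have "power_marginal A P s (snd x) > 0" for s
    proof -
      have "P x powr (1 + s) > 0" using x(2) by simp
      then show ?thesis using power_marginal_ge[OF assms(1) x(1), of P s] by linarith
    qed
    ultimately show ?thesis
      unfolding v_def escort_prob_def using pw[OF x(1)]
      by (intro continuous_on_divide) (auto simp: less_imp_neq[symmetric])
  qed
  have "continuous_on {0..} (\<lambda>s::real. s / (1 + s))"
    by (intro continuous_intros) auto
  from continuous_on_tilting[OF fin assms(3) this v(1) v(3) contv]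
  have cont: "continuous_on {0..} h" "continuous_on {0..} D"
    unfolding D_def h_def W_def Z_def by auto
  have ub: "s * (H_up A E P s - R) / (1 + 2 * s) \<le> e" if "s \<ge> 0" for s
    unfolding e_def e_d_def using that e_d_bdd_above[of A E P R] assms by (intro cSUP_upper) auto
  \<comment> \<open>Since \<open>v\<close> varies with \<open>s\<close>, its logarithm has no
    evident uniform bound. Domination of \<open>W\<close> by \<open>v\<close> bounds each term of
    \<open>h\<close> by \<open>- v * ln v\<close>, hence by 1, uniformly in
    \<open>s\<close>.\<close>
  have Wv: "W s x \<le> v s x" if s: "s \<ge> 0" and x: "x \<in> A \<times> E" for s x
  proof -
    have "power_marginal A P s (snd x) powr (1 / (1 + s)) \<le> Z s"
      unfolding ZU[OF s] up_moment_def using assms(2) x by (intro member_le_sum) auto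
    then have "power_marginal A P s (snd x) powr (1 / (1 + s)) / Z s \<le> 1"
      using up_moment_pos[OF assms(1-3) s] ZU[OF s] by simp
    from mult_left_mono[OF this v(1)[OF x, of s]] show ?thesis
      unfolding W_def using escort_tilt_term(2)[OF assms(1,3) x s] by (simp add: v_def)
  qed
  \<comment> \<open>Two \<delta> cover the balancing error and the typicality slack; the third
    absorbs the constants 1/2 and \<open>sqrt \<epsilon>\<close>.\<close>
  define \<delta> where "\<delta> = \<gamma> / 3"
  have \<delta>: "\<delta> > 0" using assms(6) by (simp add: \<delta>_def)
  define N where "N = real (card (A \<times> E))"
  text \<open>In the parameter \<open>t = 2 * s\<close> the weights of the two exponents become \<open>1\<close> and \<open>t\<close>.\<close>
  have "\<exists>t\<ge>0. D (t / 2) \<le> e + \<delta> \<and> (h (t / 2) + D (t / 2) - R) / 2 \<le> e + \<delta>"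
  proof (rule balance_exponents[OF _ _ _ _ _ \<delta>])
    have half: "continuous_on {0..} (\<lambda>t. f (t / 2))" if "continuous_on {0..} f" for f :: "real \<Rightarrow> real"
      by (rule continuous_on_compose2[OF that]) (auto intro!: continuous_intros)
    show "continuous_on {0..} (\<lambda>t. D (t / 2))" using half[OF cont(2)] .
    show "continuous_on {0..} (\<lambda>t. (h (t / 2) + D (t / 2) - R) / 2)"
      using half[OF cont(2)] half[OF cont(1)] by (intro continuous_intros) auto
    show "D (0 / 2) = 0" using tilt(3)[of 0] ZU[of 0] up_moment_0[OF assms(1-3)] by simp
    show "(h (t / 2) + D (t / 2) - R) / 2 - D (t / 2) \<le> N" if "t \<ge> 0" for t
    proof -
      define s where "s = t / 2"
      have s: "s \<ge> 0" using that by (simp add: s_def)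
      have "h s \<le> (\<Sum>x\<in>A \<times> E. 1)"
        unfolding h_def
      proof (intro sum_mono)
        fix x assume x: "x \<in> A \<times> E"
        show "W s x * - ln (v s x) \<le> 1"
        proof (cases "v s x > 0")
          case True
          have "W s x * - ln (v s x) \<le> v s x * - ln (v s x)"
            using Wv[OF s x] v(2)[OF x] True by (intro mult_right_mono) auto
          also have "\<dots> = v s x * ln (1 / v s x)" using True by (simp add: ln_div)
          also have "\<dots> \<le> v s x * (1 / v s x - 1)"
            using True by (intro mult_left_mono ln_le_minus_one) auto
          also have "\<dots> \<le> 1" using True by (simp add: algebra_simps)
          finally show ?thesis .
        next
          case False
          then have "v s x = 0" using v(1)[OF x, of s] by simp
          then show ?thesis by simp
        qed
      qed
      then have hN: "h s \<le> N" by (simp add: N_def)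
      have "0 \<le> N" by (simp add: N_def)
      with hN have "(h s + D s - R) / 2 - D s \<le> N"
        using tilt(4)[of s] assms(4) by (simp add: field_simps)
      then show ?thesis by (simp add: s_def)
    qed
    show "D (t / 2) + t * ((h (t / 2) + D (t / 2) - R) / 2) \<le> (1 + t) * e" if "t \<ge> 0" for t
    proof -
      define s where "s = t / 2"
      have s: "s \<ge> 0" using that by (simp add: s_def)
      \<comment> \<open>The formula for \<open>D\<close> multiplied by \<open>1 + s\<close>;
        subtracting \<open>s * R\<close> turns the right side into the numerator in
        \<open>e_d\<close>.\<close>
      have "(1 + s) * D s + s * h s = - (1 + s) * ln (Z s)"
        using s by (simp add: tilt(3) field_simps)
      then have "D s + s * (h s + D s - R) = s * (H_up A E P s - R)"
        using mult_H_up[OF assms(1-3) s] ZU[OF s] by (simp add: algebra_simps)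
      also have "\<dots> \<le> (1 + 2 * s) * e"
        using ub[OF s] s by (simp add: divide_le_eq mult.commute)
      finally show ?thesis by (simp add: s_def)
    qed
  qed
  then obtain t where "t \<ge> 0" "D (t / 2) \<le> e + \<delta>" "(h (t / 2) + D (t / 2) - R) / 2 \<le> e + \<delta>"
    by blast
  then obtain s where s: "s \<ge> 0" "D s \<le> e + \<delta>" "(h s + D s - R) / 2 \<le> e + \<delta>"
    by (metis divide_nonneg_nonneg zero_le_numeral)
  have "\<forall>\<^sub>F n in sequentially. \<forall>Q. prob_dist_on (words E n) Q \<longrightarrow>
    exp (- (real n * (D s + \<delta> / 3))) / 4
      \<le> excess (words A n) (words E n) (iid_power n P) Q (real n * (h s + D s + 3 * (\<delta> / 3)))"
    unfolding D_def h_def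
  proof (rule excess_iid_ge_any[OF assms(1,2) tilt(1)[of s]])
    show "\<forall>x\<in>A \<times> E. 0 \<le> P x \<and> 0 \<le> v s x" using P v by auto
    show "\<forall>x\<in>A \<times> E. 0 < W s x \<longrightarrow> 0 < P x \<and> 0 < v s x" using tilt(2) v by auto
    show "\<forall>e\<in>E. (\<Sum>a\<in>A. v s (a, e)) \<le> 1" using sum_escort_prob_le by (auto simp: v_def)
  qed (use \<delta> in auto)
  moreover have "\<forall>\<^sub>F n in sequentially. exp (- (real n * \<delta>)) \<le> min (1 / 2) (sqrt \<epsilon>)"
    using \<delta> assms(5) by (intro eventually_exp_neg_le) auto
  ultimately show ?thesis
  proof eventually_elim
    case (elim n)
    let ?\<Delta> = "Delta_d_min (words A n) (words E n) (exp (real n * R)) \<epsilon> (iid_power n P)"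
    let ?r = "real n * (h s + D s + 3 * (\<delta> / 3))"
    have "min (2 * (exp (- (real n * (D s + \<delta> / 3))) / 4))
        (sqrt \<epsilon> * exp (real n * R) powr (1 / 2) * exp (- ?r / 2)) \<le> ?\<Delta>"
      using elim(1) finite_words[OF assms(1)] finite_words[OF assms(2)] assms
        prob_dist_on_iid_power[OF assms(3), of n]
      by (intro Delta_d_min_ge) auto
    moreover have "exp (- (real n * (e + \<gamma>))) \<le> 2 * (exp (- (real n * (D s + \<delta> / 3))) / 4)"
    proof -
      have "exp (- (real n * (e + \<gamma>))) = exp (- (real n * (e + 2 * \<delta>))) * exp (- (real n * \<delta>))"
        by (simp add: \<delta>_def exp_add[symmetric] algebra_simps)
      also have "\<dots> \<le> exp (- (real n * (D s + \<delta> / 3))) * (1 / 2)"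
        using elim(2) s(2) \<delta> by (intro mult_mono) (auto intro!: mult_left_mono)
      finally show ?thesis by simp
    qed
    moreover have "exp (- (real n * (e + \<gamma>)))
        \<le> sqrt \<epsilon> * exp (real n * R) powr (1 / 2) * exp (- ?r / 2)"
    proof -
      have le: "(h s + D s - R) / 2 + \<delta> / 2 \<le> e + 2 * \<delta>" using s(3) \<delta> by linarith
      have "exp (- (real n * (e + \<gamma>))) = exp (- (real n * \<delta>)) * exp (- (real n * (e + 2 * \<delta>)))"
        by (simp add: \<delta>_def exp_add[symmetric] algebra_simps)
      also have "\<dots> \<le> sqrt \<epsilon> * exp (- (real n * ((h s + D s - R) / 2 + \<delta> / 2)))"
        using elim(2) assms(5) mult_left_mono[OF le, of "real n"] by (intro mult_mono) auto
      also have "\<dots> = sqrt \<epsilon> * exp (real n * R) powr (1 / 2) * exp (- ?r / 2)"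
        by (simp add: exp_powr_real exp_add[symmetric] algebra_simps add_divide_distrib diff_divide_distrib)
      finally show ?thesis .
    qed
    ultimately show ?case by (simp add: e_def)
  qed
qed

theorem theorem28:
  fixes A :: "'a set" and E :: "'e set" and P :: "'a \<times> 'e \<Rightarrow> real" and R \<epsilon> :: real
  assumes "finite A" and "finite E"
    and "prob_dist_on (A \<times> E) P"
    and "R > 0" and "\<epsilon> > 0"
  shows "((\<lambda>n. - 1 / real n *
             ln (Delta_d_min (words A n) (words E n) (exp (real n * R)) \<epsilon> (iid_power n P)))
            \<longlonglongrightarrow> e_d A E P R)
       \<and> ((\<lambda>n. - 1 / real n *
             ln (Delta_I_min (words A n) (words E n) (exp (real n * R)) \<epsilon> (iid_power n P)))
            \<longlonglongrightarrow> e_I A E P R)"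
  using assms
  by (intro conjI neg_log_div_tendsto Delta_d_min_iid_le Delta_d_min_iid_ge
      Delta_I_min_iid_le Delta_I_min_iid_ge)

end
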